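(* For any finite group $G$ there is a directed graph $D$ such that the group of combinatorial automorphisms of the asymmetric traveling-salesman polytope of $D$ is isomorphic to $G$.
   Context: A combinatorial automorphism of a convex polytope is a permutation of its set of vertices that maps the set of vertices of any face to the set of vertices of some face. For a finite directed graph $D$ with node set $V$ and arc set $A$, the asymmetric traveling-salesman polytope of $D$ is the convex hull in $\mathbb{R}^A$ of the characteristic vectors of the arc sets of the Hamiltonian directed cycles of $D$ (directed cycles visiting every node of $V$ exactly once). *)

theory Defs
  imports
    "HOL-Analysis.Polytope"
    "HOL-Analysis.Finite_Function_Topology"
    "HOL-Algebra.Bij"
    "Graph_Theory.Pair_Digraph"
begin

text \<open>
  As in \<open>face_of\<close>, the polytope itself and the empty set count as faces.  A combinatorial
  automorphism is required to be extensional outside the vertex set, so that distinct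
  automorphisms are distinct permutations of the vertices.
\<close>

definition polytope_vertices :: "'a::real_vector set \<Rightarrow> 'a set" where
  "polytope_vertices P = {v. v extreme_point_of P}"

definition combinatorial_automorphisms :: "'a::real_vector set \<Rightarrow> ('a \<Rightarrow> 'a) set" where
  "combinatorial_automorphisms P =
     {f \<in> Bij (polytope_vertices P).
        \<forall>F. F face_of P \<longrightarrow>
          (\<exists>F'. F' face_of P \<and> f ` polytope_vertices F = polytope_vertices F')}"

definition combinatorial_automorphism_group :: "'a::real_vector set \<Rightarrow> ('a \<Rightarrow> 'a) monoid" where
  "combinatorial_automorphism_group P =
     BijGroup (polytope_vertices P) \<lparr>carrier := combinatorial_automorphisms P\<rparr>"

lemma group_combinatorial_automorphism_group:
  assumes fin: "finite (polytope_vertices P)"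
  shows "group (combinatorial_automorphism_group P)"
proof -
  let ?V = "polytope_vertices P"
  define K where "K = {polytope_vertices F | F. F face_of P}"
  have K_sub: "W \<subseteq> ?V" if "W \<in> K" for W
    using that by (auto simp: K_def polytope_vertices_def extreme_point_of_face)
  then have "finite K"
    using finite_subset[of K "Pow ?V"] fin by blast
  have mem: "f \<in> combinatorial_automorphisms P \<longleftrightarrow> f \<in> Bij ?V \<and> (`) f ` K \<subseteq> K" for f
    unfolding combinatorial_automorphisms_def K_def image_subset_iff by blast
  interpret B: group "BijGroup ?V"
    by (rule group_BijGroup)
  have "subgroup (combinatorial_automorphisms P) (BijGroup ?V)"
  proof (rule B.subgroupI)
    show "combinatorial_automorphisms P \<subseteq> carrier (BijGroup ?V)"
      by (auto simp: mem BijGroup_def)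
    have "(\<lambda>x\<in>?V. x) ` W = W" if "W \<in> K" for W
      using image_cong[OF refl, of W "\<lambda>x\<in>?V. x" id] K_sub[OF that]
      by (simp add: subset_iff)
    then have "(\<lambda>x\<in>?V. x) \<in> combinatorial_automorphisms P"
      by (auto simp: mem id_Bij)
    then show "combinatorial_automorphisms P \<noteq> {}"
      by blast
  next
    fix f assume f: "f \<in> combinatorial_automorphisms P"
    then have fB: "f \<in> Bij ?V" and fK: "(`) f ` K \<subseteq> K"
      by (auto simp: mem)
    have inj: "inj_on f ?V"
      using fB by (simp add: Bij_def bij_betw_def)
    have "inj_on ((`) f) K"
      by (rule inj_onI) (meson inj K_sub inj_on_image_eq_iff)
    then have surj: "(`) f ` K = K"
      using \<open>finite K\<close> fK by (simp add: endo_inj_surj)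
    have "(\<lambda>x\<in>?V. inv_into ?V f x) ` W \<in> K" if "W \<in> K" for W
    proof -
      have "W \<in> (`) f ` K"
        unfolding surj by (rule that)
      then obtain W' where W': "W' \<in> K" "W = f ` W'"
        by (rule imageE)
      have "(\<lambda>x\<in>?V. inv_into ?V f x) ` W = inv_into ?V f ` f ` W'"
        using K_sub[OF that] unfolding W'(2)
        by (intro image_cong refl restrict_apply') (rule subsetD)
      also have "\<dots> = W'"
        by (rule inv_into_image_cancel[OF inj K_sub[OF W'(1)]])
      finally show ?thesis
        using W'(1) by simp
    qed
    then show "inv\<^bsub>BijGroup ?V\<^esub> f \<in> combinatorial_automorphisms P"
      using fB by (auto simp: mem inv_BijGroup restrict_inv_into_Bij)
  next
    fix f g
    assume f: "f \<in> combinatorial_automorphisms P" and g: "g \<in> combinatorial_automorphisms P"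
    have "compose ?V f g ` W = f ` g ` W" if "W \<in> K" for W
      using K_sub[OF that] by (auto simp: compose_def image_image intro!: image_cong)
    then have "(`) (compose ?V f g) ` K \<subseteq> K"
      using f g by (simp add: mem image_subset_iff)
    then show "f \<otimes>\<^bsub>BijGroup ?V\<^esub> g \<in> combinatorial_automorphisms P"
      using f g by (auto simp: mem BijGroup_def compose_Bij)
  qed
  then show ?thesis
    unfolding combinatorial_automorphism_group_def by (rule B.subgroup_imp_group)
qed

text \<open>
  Since the arc set varies with the digraph, the space of real vectors indexed by the arc
  set is realised as the coordinate subspace of \<open>('v \<times> 'v) \<Rightarrow>\<^sub>0 real\<close> of the vectors
  supported on the arcs.
\<close>

definition characteristic_vector :: "'b set \<Rightarrow> ('b \<Rightarrow>\<^sub>0 real)" where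
  "characteristic_vector S = (\<Sum>e\<in>S. Poly_Mapping.single e 1)"

lemma lookup_characteristic_vector:
  assumes "finite S"
  shows "Poly_Mapping.lookup (characteristic_vector S) e = (if e \<in> S then 1 else 0)"
  using assms
  by (simp add: characteristic_vector_def lookup_sum lookup_single when_def)

text \<open>
  The library's cycles are closed arc walks in which no node repeats, apart from the
  coincidence of start and end; hence a cycle through all nodes visits each exactly once.
\<close>

definition hamiltonian_cycle :: "'v pair_pre_digraph \<Rightarrow> ('v \<times> 'v) awalk \<Rightarrow> bool" where
  "hamiltonian_cycle D p \<longleftrightarrow>
     pre_digraph.cycle (with_proj D) p \<and> fst ` set p = pverts D"

definition atsp_polytope :: "'v pair_pre_digraph \<Rightarrow> (('v \<times> 'v) \<Rightarrow>\<^sub>0 real) set" where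
  "atsp_polytope D =
     convex hull {characteristic_vector (set p) | p. hamiltonian_cycle D p}"

lemma finite_vertices_atsp_polytope:
  assumes "pair_digraph D"
  shows "finite (polytope_vertices (atsp_polytope D))"
proof -
  interpret pair_digraph D by fact
  let ?S = "{characteristic_vector (set p) | p. hamiltonian_cycle D p}"
  have "?S \<subseteq> characteristic_vector ` Pow (parcs D)"
    by (auto simp: hamiltonian_cycle_def cycle_def awalk_def)
  then have "finite ?S"
    using pair_finite_arcs by (meson finite_Pow_iff finite_imageI finite_subset)
  moreover have "polytope_vertices (atsp_polytope D) \<subseteq> ?S"
    unfolding polytope_vertices_def atsp_polytope_def
    using extreme_point_of_convex_hull by (intro subsetI) blast
  ultimately show ?thesis
    by (rule rev_finite_subset)
qed

end

theory Submission
  imports Defs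
begin

text \<open>
  Why the theorem holds.  Consider a finite graph on the set \<open>I\<close> of vertices and its clique
  polytope, the convex hull of the indicator vectors of all cliques, the empty clique included
  (this is the stable set polytope of the complement).  Every automorphism of the graph permutes
  coordinates and so acts on the polytope.  Conversely, suppose the graph is \<^emph>\<open>undominated\<close>: every
  vertex \<open>u\<close> misses some edge, both of whose ends are different from and not adjacent to \<open>u\<close>.  Then
  the empty clique is the only vertex of the polytope with exactly \<open>card I\<close> neighbours in the
  \<open>1\<close>-skeleton, all others have more (lemmas \<open>neighbours_empty\<close> and \<open>card_neighbours\<close>).  So a
  combinatorial automorphism fixes the empty clique and permutes its neighbours, the singletons.
  Two singletons are joined in the \<open>1\<close>-skeleton iff they are not adjacent in the graph, hence the
  permutation is a graph automorphism; and the image of a clique \<open>K\<close> is forced because the subsets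
  of \<open>K\<close> form the smallest face containing the empty clique and the singletons of \<open>K\<close>.  Thus the
  combinatorial automorphism group of the polytope is the automorphism group of the graph
  (\<open>graph_automorphism_group_iso\<close>).

  A group of order \<open>n \<ge> 3\<close> is the automorphism group of an undominated graph: take \<open>n + 1\<close> copies of
  the group, arranged so that the degree reveals the copy and the adjacencies
  between the copies encode all right multiplications; the permutations that commute with these
  are the left multiplications (\<open>group_iso_automorphism_group\<close>).

  Finally every clique polytope is an asymmetric traveling-salesman polytope
  (\<open>clique_polytope_is_atsp_polytope\<close>).  The Hamiltonian cycles of the digraph constructed below
  correspond to the cliques, and each arc is used or not according to an affine function of the
  indicator vector of the clique.  A graph vertex \<open>i\<close> becomes a row of gadgets; a Hamiltonian
  cycle traverses all of them in one sweep if \<open>i\<close> is not in the clique, and otherwise picks them up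
  one by one in the opposite direction, on detours that compete with the detours of the vertices not
  adjacent to \<open>i\<close>.

  Groups of order \<open>1\<close> and \<open>2\<close> are the symmetry groups of the empty polytope and of a segment.
\<close>

section \<open>Faces of clique polytopes\<close>

lemma supporting_hyperplane_face:
  assumes "convex S" "linear f" "\<And>x. x \<in> S \<Longrightarrow> f x \<le> (b :: real)"
  shows "{x \<in> S. f x = b} face_of S"
proof -
  interpret f: linear f by fact
  have "x \<in> S \<and> f x = b \<and> y \<in> S \<and> f y = b"
    if *: "x \<in> S" "y \<in> S" "z \<in> open_segment x y" "f z = b" for x y z
  proof -
    obtain u where u: "0 < u" "u < 1" "z = (1 - u) *\<^sub>R x + u *\<^sub>R y"
      using *(3) unfolding in_segment by blast
    have 1: "b = (1 - u) * f x + u * f y"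
      using u that by (simp add: f.add f.scaleR)
    have 2: "(1 - u) * f x \<le> (1 - u) * b" "u * f y \<le> u * b"
      using u assms(3) that by auto
    have 3: "(1 - u) * b + u * b = b"
      by (simp add: algebra_simps)
    then have "(1 - u) * f x = (1 - u) * b" "u * f y = u * b"
      using 1 2 by linarith+
    then show ?thesis
      using u that by simp
  qed
  moreover have "convex {x \<in> S. f x = b}"
  proof -
    have "convex (S \<inter> f -` {b})"
      using assms by (intro convex_Int convex_linear_vimage) auto
    then show ?thesis
      by (simp add: vimage_def Int_def)
  qed
  ultimately show ?thesis
    unfolding face_of_def by blast
qed

definition cliques :: "'i set \<Rightarrow> ('i \<Rightarrow> 'i \<Rightarrow> bool) \<Rightarrow> 'i set set" where
  "cliques I E = {K. K \<subseteq> I \<and> (\<forall>u\<in>K. \<forall>v\<in>K. u \<noteq> v \<longrightarrow> E u v)}"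

definition graph_automorphisms :: "'i set \<Rightarrow> ('i \<Rightarrow> 'i \<Rightarrow> bool) \<Rightarrow> ('i \<Rightarrow> 'i) set" where
  "graph_automorphisms I E = {\<phi> \<in> Bij I. \<forall>u\<in>I. \<forall>v\<in>I. E (\<phi> u) (\<phi> v) \<longleftrightarrow> E u v}"

definition graph_automorphism_group :: "'i set \<Rightarrow> ('i \<Rightarrow> 'i \<Rightarrow> bool) \<Rightarrow> ('i \<Rightarrow> 'i) monoid" where
  "graph_automorphism_group I E = BijGroup I \<lparr>carrier := graph_automorphisms I E\<rparr>"

text \<open>
  The polytope is described up to affine equivalence: instead of indicator vectors in
  coordinate space, the points are \<open>p0 + (\<Sum>i\<in>K. d i)\<close> in any real vector space on which
  linear functionals \<open>c i\<close> dual to the directions \<open>d i\<close> exist.  In this form it applies verbatim to the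
  traveling-salesman polytope, whose ambient space has one coordinate for each arc.
\<close>
locale clique_polytope =
  fixes I :: "'i set" and E :: "'i \<Rightarrow> 'i \<Rightarrow> bool"
    and p0 :: "'e::real_vector" and d :: "'i \<Rightarrow> 'e" and c :: "'i \<Rightarrow> 'e \<Rightarrow> real"
  assumes finite_I: "finite I"
    and E_sym: "E u v \<Longrightarrow> E v u"
    and E_irrefl: "\<not> E u u"
    and linear_c: "i \<in> I \<Longrightarrow> linear (c i)"
    and c_d: "i \<in> I \<Longrightarrow> j \<in> I \<Longrightarrow> c i (d j) = (if i = j then 1 else 0)"
begin

definition pt :: "'i set \<Rightarrow> 'e" where
  "pt K = p0 + (\<Sum>i\<in>K. d i)"

definition P :: "'e set" where
  "P = convex hull (pt ` cliques I E)"

definition facial :: "'i set set \<Rightarrow> bool" where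
  "facial X \<longleftrightarrow> (\<exists>F. F face_of P \<and> X = {K \<in> cliques I E. pt K \<in> F})"

definition lin :: "('i \<Rightarrow> real) \<Rightarrow> 'e \<Rightarrow> real" where
  "lin w x = (\<Sum>i\<in>I. w i * c i x)"

lemma linear_lin: "linear (lin w)"
proof (rule linearI)
  show "lin w (x + y) = lin w x + lin w y" for x y
    unfolding lin_def sum.distrib[symmetric]
    by (intro sum.cong refl) (simp add: linear_add[OF linear_c] distrib_left)
  show "lin w (r *\<^sub>R x) = r *\<^sub>R lin w x" for r x
    unfolding lin_def scaleR_sum_right
    by (intro sum.cong refl) (simp add: linear_scale[OF linear_c])
qed

lemma clique_subset: "K \<in> cliques I E \<Longrightarrow> K \<subseteq> I"
  by (simp add: cliques_def)

lemma finite_clique: "K \<in> cliques I E \<Longrightarrow> finite K"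
  using clique_subset finite_I finite_subset by blast

lemma finite_cliques: "finite (cliques I E)"
  using finite_I clique_subset by (meson Pow_iff finite_Pow_iff finite_subset subsetI)

lemma clique_mono: "K \<in> cliques I E \<Longrightarrow> L \<subseteq> K \<Longrightarrow> L \<in> cliques I E"
  by (auto simp: cliques_def dest: subsetD)

lemma empty_clique: "{} \<in> cliques I E"
  by (simp add: cliques_def)

lemma singleton_clique: "u \<in> I \<Longrightarrow> {u} \<in> cliques I E"
  by (simp add: cliques_def)

lemma c_pt:
  assumes "K \<subseteq> I" "i \<in> I"
  shows "c i (pt K) = c i p0 + (if i \<in> K then 1 else 0)"
proof -
  interpret linear "c i" by (rule linear_c) fact
  have "c i (pt K) = c i p0 + (\<Sum>j\<in>K. if j = i then 1 else 0)"
    unfolding pt_def add sum using assms c_d by (auto intro!: sum.cong)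
  then show ?thesis
    using finite_subset[OF assms(1) finite_I] by simp
qed

lemma lin_pt:
  assumes "K \<subseteq> I"
  shows "lin w (pt K) = lin w p0 + sum w K"
proof -
  have "lin w (pt K) = lin w p0 + (\<Sum>i\<in>I. if i \<in> K then w i else 0)"
    unfolding lin_def sum.distrib[symmetric]
    by (intro sum.cong refl) (simp add: c_pt assms algebra_simps)
  also have "(\<Sum>i\<in>I. if i \<in> K then w i else 0) = sum w K"
    using sum.inter_restrict[OF finite_I, of w K] assms by (simp add: Int_absorb1)
  finally show ?thesis .
qed

lemma pt_inject:
  assumes "K \<subseteq> I" "L \<subseteq> I"
  shows "pt K = pt L \<longleftrightarrow> K = L"
proof
  assume eq: "pt K = pt L"
  have "i \<in> K \<longleftrightarrow> i \<in> L" if "i \<in> I" for i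
    using c_pt[OF assms(1) that] c_pt[OF assms(2) that] unfolding eq by (simp split: if_splits)
  then show "K = L"
    using assms by blast
qed simp

lemma inj_on_pt: "inj_on pt (cliques I E)"
  by (auto intro!: inj_onI dest: pt_inject[OF clique_subset clique_subset])

lemma pt_in_P: "K \<in> cliques I E \<Longrightarrow> pt K \<in> P"
  unfolding P_def by (simp add: hull_inc)

lemma facialI:
  fixes w :: "'i \<Rightarrow> real"
  assumes "\<And>K. K \<in> cliques I E \<Longrightarrow> sum w K \<le> m"
  shows "facial {K \<in> cliques I E. sum w K = m}"
proof -
  have "P \<subseteq> {x. lin w x \<le> lin w p0 + m}"
    unfolding P_def
  proof (rule hull_minimal)
    show "convex {x. lin w x \<le> lin w p0 + m}"
      using convex_linear_vimage[OF linear_lin, of "{..lin w p0 + m}" w] by (simp add: vimage_def)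
  qed (use assms lin_pt clique_subset in auto)
  then have "{x \<in> P. lin w x = lin w p0 + m} face_of P"
    by (intro supporting_hyperplane_face linear_lin) (auto simp: P_def)
  then show ?thesis
    unfolding facial_def using pt_in_P lin_pt[OF clique_subset]
    by (intro exI[of _ "{x \<in> P. lin w x = lin w p0 + m}"]) auto
qed

text \<open>
  The common midpoint of the two pairs lies in the face, so the face contains both ends of each
  segment through it.  All non-edges of the polytope that matter are detected in this way.
\<close>
lemma facial_exchange:
  assumes "facial X" "K \<in> X" "L \<in> X" "K' \<in> cliques I E" "L' \<in> cliques I E"
    and eq: "pt K + pt L = pt K' + pt L'"
  shows "K' \<in> X"
proof -
  obtain F where F: "F face_of P" "X = {K \<in> cliques I E. pt K \<in> F}"
    using assms(1) by (auto simp: facial_def)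
  define x where "x = (1/2) *\<^sub>R pt K + (1/2) *\<^sub>R pt L"
  have x: "x = (1/2) *\<^sub>R pt K' + (1/2) *\<^sub>R pt L'"
    unfolding x_def using eq by (metis scaleR_add_right)
  have "convex F"
    using F(1) by (rule face_of_imp_convex)
  then have xF: "x \<in> F"
    unfolding x_def using assms F by (intro convexD) auto
  have "pt K' \<in> F"
  proof (cases "pt K' = pt L'")
    case True
    then have "x = pt K'"
      unfolding x by (simp flip: scaleR_add_left)
    then show ?thesis using xF by simp
  next
    case False
    then have "x \<in> open_segment (pt K') (pt L')"
      unfolding x by (auto simp: in_segment intro!: exI[of _ "1/2"])
    then show ?thesis
      using face_ofD[OF F(1)] xF pt_in_P assms by blast
  qed
  then show ?thesis
    using assms F by auto
qed

text \<open>
  The weight \<open>1\<close> on \<open>K\<close> and \<open>-1\<close> off \<open>K\<close> is maximised by \<open>K\<close> alone among the cliques, and then \<open>pt K\<close>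
  is the only maximiser on the whole polytope: the set \<open>T\<close> in the proof is convex and contains all
  the generating points.
\<close>
lemma vertices_P: "polytope_vertices P = pt ` cliques I E"
proof
  show "polytope_vertices P \<subseteq> pt ` cliques I E"
    unfolding polytope_vertices_def P_def using extreme_point_of_convex_hull by auto
  show "pt ` cliques I E \<subseteq> polytope_vertices P"
  proof
    fix x assume "x \<in> pt ` cliques I E"
    then obtain K where K: "K \<in> cliques I E" "x = pt K" by blast
    define w :: "'i \<Rightarrow> real" where "w = (\<lambda>i. if i \<in> K then 1 else - 1)"
    define m where "m = lin w (pt K)"
    define T where "T = insert (pt K) {x. lin w x < m}"
    have less: "lin w (pt L) < m" if "L \<in> cliques I E" "L \<noteq> K" for L
    proof -
      have fin: "finite L" "finite K"
        using that K finite_clique by auto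
      have "sum w L = real (card (L \<inter> K)) - real (card (L - K))"
        using sum.Int_Diff[OF fin(1), of w K] by (simp add: w_def)
      moreover have "card (L \<inter> K) + card (K - L) = card K"
        using fin by (metis Int_commute card_Int_Diff)
      moreover have "card (L - K) + card (K - L) > 0"
        using fin that by (auto simp: card_gt_0_iff)
      moreover have "sum w K = real (card K)"
        by (simp add: w_def)
      ultimately have "sum w L < sum w K" by linarith
      then show ?thesis
        using that K by (simp add: m_def lin_pt clique_subset)
    qed
    interpret lin: linear "lin w" by (rule linear_lin)
    have "convex T"
    proof (rule convexI)
      fix x y and u v :: real
      assume *: "x \<in> T" "y \<in> T" "0 \<le> u" "0 \<le> v" "u + v = 1"
      show "u *\<^sub>R x + v *\<^sub>R y \<in> T"
      proof (cases "x = pt K \<and> y = pt K \<or> u = 0 \<or> v = 0")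
        case True
        then show ?thesis
          using * by (auto simp flip: scaleR_add_left)
      next
        case False
        then have "u > 0" "v > 0" using * by auto
        have le: "lin w x \<le> m" "lin w y \<le> m"
          using * by (auto simp: T_def m_def)
        have "lin w x < m \<or> lin w y < m"
          using False * by (auto simp: T_def)
        then have "u * lin w x + v * lin w y < u * m + v * m"
          using le \<open>u > 0\<close> \<open>v > 0\<close>
          by (auto intro: add_less_le_mono add_le_less_mono)
        also have "u * m + v * m = m"
          using * by (simp flip: distrib_right)
        finally show ?thesis
          by (simp add: T_def lin.add lin.scaleR)
      qed
    qed
    then have "P \<subseteq> T"
      unfolding P_def using less by (intro hull_minimal) (auto simp: T_def)
    then have "{x \<in> P. lin w x = m} = {pt K}"
      using pt_in_P K by (auto simp: T_def m_def)
    moreover have "{x \<in> P. lin w x = m} face_of P"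
      using \<open>P \<subseteq> T\<close> by (intro supporting_hyperplane_face linear_lin) (auto simp: P_def T_def m_def)
    ultimately show "x \<in> polytope_vertices P"
      by (simp add: polytope_vertices_def face_of_singleton K)
  qed
qed

lemma vertices_face:
  assumes "F face_of P"
  shows "polytope_vertices F = pt ` {K \<in> cliques I E. pt K \<in> F}"
  using vertices_P extreme_point_of_face[OF assms]
  unfolding polytope_vertices_def by auto

lemma facial_iff: "facial X \<longleftrightarrow> X \<subseteq> cliques I E \<and> (\<exists>F. F face_of P \<and> polytope_vertices F = pt ` X)"
proof
  assume "facial X"
  then show "X \<subseteq> cliques I E \<and> (\<exists>F. F face_of P \<and> polytope_vertices F = pt ` X)"
    by (auto simp: facial_def vertices_face)
next
  assume *: "X \<subseteq> cliques I E \<and> (\<exists>F. F face_of P \<and> polytope_vertices F = pt ` X)"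
  then obtain F where F: "F face_of P" "pt ` {K \<in> cliques I E. pt K \<in> F} = pt ` X"
    using vertices_face by auto
  have "{K \<in> cliques I E. pt K \<in> F} = X"
    by (rule iffD1[OF inj_on_image_eq_iff[OF inj_on_pt _ conjunct1[OF *]] F(2)]) auto
  then show "facial X"
    using F by (auto simp: facial_def)
qed

section \<open>Edges of clique polytopes\<close>

text \<open>
  A weight that is \<open>1\<close> on \<open>K\<close> and \<open>a\<close> elsewhere exposes an edge at \<open>K\<close>: passing from \<open>K\<close> to \<open>L\<close> loses
  \<open>card (K - L)\<close> and gains \<open>sum a (L - K)\<close>.
\<close>
lemma edge_facial:
  fixes a :: "'i \<Rightarrow> real"
  assumes K: "K \<in> cliques I E" and B: "B \<in> cliques I E"
    and le: "\<And>L. L \<in> cliques I E \<Longrightarrow> sum a (L - K) \<le> card (K - L)"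
    and eq: "\<And>L. L \<in> cliques I E \<Longrightarrow> sum a (L - K) = card (K - L) \<Longrightarrow> L = K \<or> L = B"
    and eqB: "sum a (B - K) = card (K - B)"
  shows "facial {K, B}"
proof -
  define w :: "'i \<Rightarrow> real" where "w = (\<lambda>k. if k \<in> K then 1 else a k)"
  have w: "sum w L = real (card K) - real (card (K - L)) + sum a (L - K)" if "L \<in> cliques I E" for L
  proof -
    have fin: "finite L" "finite K"
      using that K finite_clique by auto
    have "sum w L = real (card (L \<inter> K)) + sum a (L - K)"
      using sum.Int_Diff[OF fin(1), of w K] by (simp add: w_def)
    moreover have "card K = card (L \<inter> K) + card (K - L)"
      using fin by (metis Int_commute card_Int_Diff)
    ultimately show ?thesis by simp
  qed
  have "facial {L \<in> cliques I E. sum w L = real (card K)}"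
    by (rule facialI) (use le in \<open>simp add: w\<close>)
  moreover have "{L \<in> cliques I E. sum w L = real (card K)} = {K, B}"
  proof (rule Set.set_eqI, rule iffI)
    fix L assume "L \<in> {L \<in> cliques I E. sum w L = real (card K)}"
    then have "L = K \<or> L = B"
      using w by (intro eq) auto
    then show "L \<in> {K, B}"
      by simp
  next
    fix L assume "L \<in> {K, B}"
    then show "L \<in> {L \<in> cliques I E. sum w L = real (card K)}"
      using K B w[OF K] w[OF B] eqB by auto
  qed
  ultimately show ?thesis by simp
qed

text \<open>
  Adding \<open>v\<close> to \<open>K\<close> drives out exactly the set \<open>T\<close> of non-neighbours of \<open>v\<close> in \<open>K\<close>, so the
  weight \<open>card T\<close> for \<open>v\<close> makes the exchange neutral and every other move a loss.  Read
  backwards, with \<open>T\<close> empty, the same lemma yields the edges that remove one element.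
\<close>
lemma edge_add_one:
  assumes K: "K \<in> cliques I E" and v: "v \<in> I" "v \<notin> K"
  shows "facial {K, insert v {k \<in> K. E k v}}"
proof -
  define T where "T = {k \<in> K. \<not> E k v}"
  define a :: "'i \<Rightarrow> real" where "a = (\<lambda>k. if k = v then real (card T) else - 1)"
  let ?B = "insert v {k \<in> K. E k v}"
  have fK: "finite K" using K finite_clique by blast
  have B: "?B \<in> cliques I E"
    using K v E_sym unfolding cliques_def by auto
  have in_case: "sum a (L - K) = card T - real (card (L - K - {v}))" "T \<subseteq> K - L"
    if L: "L \<in> cliques I E" "v \<in> L" for L
  proof -
    have "L - K = insert v (L - K - {v})" using that v by auto
    moreover have "finite L" using L finite_clique by blast
    ultimately have "sum a (L - K) = a v + sum a (L - K - {v})"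
      using v L by (simp add: sum.remove)
    moreover have "sum a (L - K - {v}) = sum (\<lambda>_. - 1) (L - K - {v})"
      by (rule sum.cong) (auto simp: a_def)
    ultimately show "sum a (L - K) = card T - real (card (L - K - {v}))"
      by (simp add: a_def)
    show "T \<subseteq> K - L"
      using L v by (auto simp: T_def cliques_def)
  qed
  have out_case: "sum a (L - K) = - real (card (L - K))" if "v \<notin> L" for L
  proof -
    have "sum a (L - K) = sum (\<lambda>_. - 1) (L - K)"
      using that by (intro sum.cong) (auto simp: a_def)
    then show ?thesis by simp
  qed
  show ?thesis
  proof (rule edge_facial[OF K B, where a = a])
    fix L assume L: "L \<in> cliques I E"
    have fL: "finite L" using L finite_clique by blast
    show "sum a (L - K) \<le> card (K - L)"
    proof (cases "v \<in> L")
      case True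
      have "card T \<le> card (K - L)"
        using in_case(2)[OF L True] fK by (intro card_mono) auto
      then show ?thesis using in_case(1)[OF L True] by simp
    qed (use out_case in auto)
    assume eq: "sum a (L - K) = card (K - L)"
    show "L = K \<or> L = ?B"
    proof (cases "v \<in> L")
      case True
      have "card T \<le> card (K - L)"
        using in_case(2)[OF L True] fK by (intro card_mono) auto
      then have *: "card (L - K - {v}) = 0" "card T = card (K - L)"
        using in_case(1)[OF L True] eq by linarith+
      then have 1: "L - K \<subseteq> {v}" using fL by (auto simp: card_eq_0_iff)
      have "T = K - L"
        using * in_case(2)[OF L True] fK by (intro card_subset_eq) auto
      with 1 True have "L = ?B" by (auto simp: T_def)
      then show ?thesis ..
    next
      case False
      then have "card (L - K) = 0" "card (K - L) = 0"
        using eq out_case[OF False] by linarith+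
      then show ?thesis using fL fK by auto
    qed
  next
    have "K - ?B = T"
      using v by (auto simp: T_def)
    moreover have "?B - K - {v} = {}" by auto
    ultimately show "sum a (?B - K) = card (K - ?B)"
      using in_case(1)[OF B insertI1] by (simp only: card.empty)
  qed
qed

text \<open>
  Adding both ends of an edge \<open>v w\<close> drives out \<open>S \<union> T\<close>.  The common non-neighbour \<open>u\<close> makes this union
  smaller than \<open>card S + card T\<close>, so the weights of \<open>v\<close> and \<open>w\<close> can add up to \<open>card (S \<union> T)\<close>
  although each of them alone is too small to pay for adding only \<open>v\<close> or only \<open>w\<close>.
\<close>
lemma edge_add_two:
  assumes K: "K \<in> cliques I E" and v: "v \<in> I" "v \<notin> K" and w: "w \<in> I" "w \<notin> K"
    and vw: "E v w" "v \<noteq> w" and u: "u \<in> K" "\<not> E u v" "\<not> E u w"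
  shows "facial {K, insert v (insert w {k \<in> K. E k v \<and> E k w})}"
proof -
  define S where "S = {k \<in> K. \<not> E k v}"
  define T where "T = {k \<in> K. \<not> E k w}"
  define h where "h = real (card (S \<inter> T)) / 2"
  define a :: "'i \<Rightarrow> real" where
    "a = (\<lambda>k. if k = v then card S - h else if k = w then card T - h else - 1)"
  let ?B = "insert v (insert w {k \<in> K. E k v \<and> E k w})"
  have fK: "finite K" using K finite_clique by blast
  then have fST: "finite S" "finite T"
    by (auto simp: S_def T_def)
  have "S \<inter> T \<noteq> {}"
    using u by (auto simp: S_def T_def)
  then have h: "h > 0"
    using fST by (simp add: h_def card_gt_0_iff)
  have cST: "real (card (S \<union> T)) = card S + card T - 2 * h"
    using card_Un_Int[OF fST] by (simp add: h_def)
  have B: "?B \<in> cliques I E"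
    using K v w vw E_sym unfolding cliques_def by auto
  have sub: "v \<in> L \<Longrightarrow> S \<subseteq> K - L" "w \<in> L \<Longrightarrow> T \<subseteq> K - L" if L: "L \<in> cliques I E" for L
    using L v w by (auto simp: S_def T_def cliques_def)
  have card_le: "card X \<le> card (K - L)" if "X \<subseteq> K - L" for X L
    using that fK by (intro card_mono) auto
  have sum_a: "sum a (L - K) = (if v \<in> L then card S - h else 0) + (if w \<in> L then card T - h else 0)
      - real (card (L - K - {v, w}))" if L: "L \<in> cliques I E" for L
  proof -
    have fL: "finite L" using L finite_clique by blast
    have "sum a (L - K) = sum a ((L - K) \<inter> {v, w}) + sum a (L - K - {v, w})"
      using fL by (intro sum.Int_Diff) auto
    moreover have "sum a (L - K - {v, w}) = sum (\<lambda>_. - 1) (L - K - {v, w})"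
      by (rule sum.cong) (auto simp: a_def)
    moreover have "(L - K) \<inter> {v, w} = (if v \<in> L then {v} else {}) \<union> (if w \<in> L then {w} else {})"
      using v w by auto
    ultimately show ?thesis
      using vw by (auto simp: a_def)
  qed
  show ?thesis
  proof (rule edge_facial[OF K B, where a = a])
    fix L assume L: "L \<in> cliques I E"
    have fL: "finite L" using L finite_clique by blast
    have le1: "card S \<le> card (K - L)" if "v \<in> L" using card_le sub[OF L] that by blast
    have le2: "card T \<le> card (K - L)" if "w \<in> L" using card_le sub[OF L] that by blast
    have le3: "card (S \<union> T) \<le> card (K - L)" if "v \<in> L" "w \<in> L"
      using sub[OF L] that by (intro card_le) auto
    show "sum a (L - K) \<le> card (K - L)"
      unfolding sum_a[OF L] using le1 le2 le3 h cST by auto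
    assume eq: "sum a (L - K) = card (K - L)"
    show "L = K \<or> L = ?B"
    proof (cases "v \<in> L \<and> w \<in> L")
      case True
      then have *: "card (L - K - {v, w}) = 0" "card (S \<union> T) = card (K - L)"
        using eq sum_a[OF L] le3 cST by auto
      then have 1: "L - K \<subseteq> {v, w}" using fL by (auto simp: card_eq_0_iff)
      have "S \<union> T = K - L"
        using * sub[OF L] True fK by (intro card_subset_eq) auto
      with 1 True have "L = ?B" by (auto simp: S_def T_def)
      then show ?thesis ..
    next
      case False
      then have *: "v \<notin> L" "w \<notin> L"
        using eq sum_a[OF L] le1 le2 h by (auto split: if_splits)
      then have "card (L - K - {v, w}) = 0" "card (K - L) = 0"
        using eq sum_a[OF L] by auto
      then show ?thesis using fL fK * by auto
    qed
  next
    have "K - ?B = S \<union> T"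
      using v w by (auto simp: S_def T_def)
    moreover have "?B - K - {v, w} = {}" by auto
    ultimately show "sum a (?B - K) = card (K - ?B)"
      using sum_a[OF B] cST by (simp only: card.empty) simp
  qed
qed

definition neighbours :: "'i set \<Rightarrow> 'i set set" where
  "neighbours K = {L \<in> cliques I E. L \<noteq> K \<and> facial {K, L}}"

lemma finite_neighbours: "finite (neighbours K)"
  unfolding neighbours_def using finite_cliques by simp

lemma pt_insert:
  assumes "finite K" "u \<notin> K"
  shows "pt (insert u K) = pt K + d u"
  using assms by (simp add: pt_def add_ac)

lemma neighbours_empty: "neighbours {} = (\<lambda>u. {u}) ` I"
proof
  show "(\<lambda>u. {u}) ` I \<subseteq> neighbours {}"
    using edge_add_one[OF empty_clique] singleton_clique by (auto simp: neighbours_def)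
  show "neighbours {} \<subseteq> (\<lambda>u. {u}) ` I"
  proof
    fix K assume "K \<in> neighbours {}"
    then have K: "K \<in> cliques I E" "K \<noteq> {}" "facial {{}, K}"
      by (auto simp: neighbours_def)
    then obtain u where u: "u \<in> K" by blast
    then have "u \<in> I" using K clique_subset by blast
    have "pt {} + pt K = pt {u} + pt (K - {u})"
      using pt_insert[of "K - {u}" u] pt_insert[of "{}" u] finite_clique[OF K(1)] u
      by (simp add: insert_absorb)
    then have "{u} \<in> {{}, K}"
      using facial_exchange[OF K(3) _ _ singleton_clique[OF \<open>u \<in> I\<close>], of "{}" K "K - {u}"] K
        clique_mono[OF K(1)] by auto
    then show "K \<in> (\<lambda>u. {u}) ` I"
      using \<open>u \<in> I\<close> by auto
  qed
qed

lemma singleton_edge_iff: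
  assumes "u \<in> I" "v \<in> I" "u \<noteq> v"
  shows "facial {{u}, {v}} \<longleftrightarrow> \<not> E u v"
proof
  assume f: "facial {{u}, {v}}"
  show "\<not> E u v"
  proof
    assume "E u v"
    then have "{u, v} \<in> cliques I E"
      using assms E_sym by (auto simp: cliques_def)
    moreover have "pt {u} + pt {v} = pt {} + pt {u, v}"
      using assms by (simp add: pt_def)
    ultimately have "{} \<in> {{u}, {v}}"
      using facial_exchange[OF f _ _ empty_clique] by blast
    then show False by simp
  qed
next
  assume "\<not> E u v"
  then have *: "{k \<in> {u}. E k v} = {}" by auto
  show "facial {{u}, {v}}"
    using edge_add_one[OF singleton_clique[OF assms(1)], of v] assms unfolding * by simp
qed

text \<open>
  Toggling any \<open>k \<in> I\<close> gives \<open>card I\<close> distinct neighbours of \<open>K\<close>, each with at most one element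
  outside \<open>K\<close>; adding \<open>v\<close> and \<open>w\<close> together gives one more.
\<close>
lemma card_neighbours:
  assumes K: "K \<in> cliques I E" and u: "u \<in> K"
    and v: "v \<in> I" and w: "w \<in> I"
    and vw: "E v w" "v \<noteq> w" and uvw: "u \<noteq> v" "u \<noteq> w" "\<not> E u v" "\<not> E u w"
  shows "card I < card (neighbours K)"
proof -
  have vK: "v \<notin> K" "w \<notin> K"
    using K u uvw by (auto simp: cliques_def)
  define f where "f = (\<lambda>k. if k \<in> K then K - {k} else insert k {l \<in> K. E l k})"
  let ?B = "insert v (insert w {k \<in> K. E k v \<and> E k w})"
  have f_nb: "f k \<in> neighbours K" if "k \<in> I" for k
  proof (cases "k \<in> K")
    case True
    have *: "K - {k} \<in> cliques I E" using K clique_mono by blast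
    have "insert k {l \<in> K - {k}. E l k} = K"
      using K True by (auto simp: cliques_def)
    then have "facial {K - {k}, K}"
      using edge_add_one[OF *, of k] that by simp
    then show ?thesis
      using * True by (auto simp: neighbours_def f_def insert_commute)
  next
    case False
    have "insert k {l \<in> K. E l k} \<in> cliques I E"
      using K that E_sym unfolding cliques_def by auto
    then show ?thesis
      using edge_add_one[OF K that False] False by (auto simp: neighbours_def f_def)
  qed
  have B: "?B \<in> neighbours K"
  proof -
    have "?B \<in> cliques I E"
      using K v w vw E_sym unfolding cliques_def by auto
    then show ?thesis
      using edge_add_two[OF K v vK(1) w vK(2) vw u uvw(3,4)] vK by (auto simp: neighbours_def)
  qed
  have inj: "inj_on f I"
    by (rule inj_onI) (auto simp: f_def split: if_splits)
  have "?B \<notin> f ` I"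
  proof
    assume "?B \<in> f ` I"
    then obtain k where "?B = f k" by blast
    then have "v \<in> f k - K" "w \<in> f k - K" using vK by auto
    then show False
      using vw by (auto simp: f_def split: if_splits)
  qed
  then have "card (insert ?B (f ` I)) = Suc (card I)"
    using finite_I inj by (simp add: card_image)
  moreover have "card (insert ?B (f ` I)) \<le> card (neighbours K)"
    using B f_nb by (intro card_mono finite_neighbours) auto
  ultimately show ?thesis by simp
qed

text \<open>Weight \<open>0\<close> on \<open>K\<close> and \<open>-1\<close> off \<open>K\<close> exposes the cube of subsets of \<open>K\<close>.\<close>
lemma facial_Pow:
  assumes "K \<in> cliques I E"
  shows "facial (Pow K)"
proof -
  define w :: "'i \<Rightarrow> real" where "w = (\<lambda>k. if k \<in> K then 0 else - 1)"
  have w: "sum w L = - real (card (L - K))" if "L \<in> cliques I E" for L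
  proof -
    have "sum w L = sum w (L \<inter> K) + sum w (L - K)"
      using finite_clique[OF that] by (rule sum.Int_Diff)
    then show ?thesis by (simp add: w_def)
  qed
  have "facial {L \<in> cliques I E. sum w L = 0}"
    by (rule facialI) (simp add: w)
  moreover have "{L \<in> cliques I E. sum w L = 0} = Pow K"
    using w finite_clique clique_mono[OF assms] by auto
  ultimately show ?thesis by simp
qed

text \<open>
  Together with \<open>facial_Pow\<close>: the subsets of \<open>K\<close> form the smallest face through the empty clique and
  the singletons of \<open>K\<close>.  The square with corners \<open>{}\<close>, \<open>{u}\<close>, \<open>L\<close>, \<open>insert u L\<close> drives the induction.
\<close>
lemma facial_contains_Pow:
  assumes X: "facial X" "{} \<in> X" "\<And>u. u \<in> K \<Longrightarrow> {u} \<in> X" and K: "K \<in> cliques I E"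
  shows "Pow K \<subseteq> X"
proof
  fix L assume "L \<in> Pow K"
  then have "finite L" "L \<subseteq> K"
    using finite_clique[OF K] finite_subset by auto
  then show "L \<in> X"
  proof (induction L)
    case empty
    then show ?case using X by simp
  next
    case (insert u L)
    have "pt L + pt {u} = pt (insert u L) + pt {}"
      using insert by (simp add: pt_def)
    then show ?case
      using facial_exchange[OF X(1) insert.IH X(3) clique_mono[OF K] empty_clique] insert.prems
      by auto
  qed
qed

definition undominated :: bool where
  "undominated \<longleftrightarrow> (\<forall>u\<in>I. \<exists>v\<in>I. \<exists>w\<in>I. E v w \<and> v \<noteq> w \<and> u \<noteq> v \<and> u \<noteq> w \<and> \<not> E u v \<and> \<not> E u w)"

text \<open>
  Everything is finite, so counting replaces arguments about the inverse of \<open>h\<close> throughout: degrees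
  in the \<open>1\<close>-skeleton can only grow, non-adjacent pairs go to non-adjacent pairs, and the image of
  the face \<open>Pow K\<close> contains, hence equals, the cube over the image of \<open>K\<close>.
\<close>
lemma facial_bijection_induced:
  assumes und: "undominated"
    and h: "bij_betw h (cliques I E) (cliques I E)"
    and hf: "\<And>X. facial X \<Longrightarrow> facial (h ` X)"
  obtains \<phi> where "\<phi> \<in> graph_automorphisms I E" "\<And>K. K \<in> cliques I E \<Longrightarrow> h K = \<phi> ` K"
proof -
  have inj: "inj_on h (cliques I E)" and ran: "h ` cliques I E = cliques I E"
    using h by (auto simp: bij_betw_def)
  have hK: "h K \<in> cliques I E" if "K \<in> cliques I E" for K
    using ran that by blast
  have nb: "h ` neighbours K \<subseteq> neighbours (h K)" if "K \<in> cliques I E" for K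
  proof
    fix M assume "M \<in> h ` neighbours K"
    then obtain L where L: "M = h L" "L \<in> cliques I E" "L \<noteq> K" "facial {K, L}"
      by (auto simp: neighbours_def)
    have "h L \<noteq> h K"
      using L that inj by (auto dest: inj_onD)
    moreover have "facial {h K, h L}"
      using hf[OF L(4)] by simp
    ultimately show "M \<in> neighbours (h K)"
      using L hK by (simp add: neighbours_def)
  qed
  \<comment> \<open>The clique sent to the empty one has at most as many neighbours as the empty one, hence is empty.\<close>
  have h_empty: "h {} = {}"
  proof -
    obtain K where K: "K \<in> cliques I E" "h K = {}"
      using ran empty_clique by (metis imageE)
    have "card (neighbours K) = card (h ` neighbours K)"
      using inj by (intro card_image[symmetric]) (auto intro: inj_on_subset simp: neighbours_def)
    also have "\<dots> \<le> card (neighbours {})"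
      using nb[OF K(1)] K by (intro card_mono finite_neighbours) auto
    also have "\<dots> = card I"
      unfolding neighbours_empty by (intro card_image) auto
    finally have "\<not> card I < card (neighbours K)" by simp
    then have "K = {}"
      using und card_neighbours[OF K(1)] clique_subset[OF K(1)] unfolding undominated_def
      by (metis equals0I subsetD)
    then show ?thesis using K by simp
  qed
  have "\<exists>v\<in>I. h {u} = {v}" if "u \<in> I" for u
  proof -
    have "h {u} \<in> neighbours {}"
      using nb[OF empty_clique] that unfolding h_empty neighbours_empty by auto
    then show ?thesis
      unfolding neighbours_empty by auto
  qed
  then obtain f where f: "\<And>u. u \<in> I \<Longrightarrow> f u \<in> I \<and> h {u} = {f u}"
    by metis
  define \<phi> where "\<phi> = restrict f I"
  have \<phi>: "\<phi> u \<in> I" "h {u} = {\<phi> u}" if "u \<in> I" for u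
    using f that by (auto simp: \<phi>_def)
  have inj\<phi>: "inj_on \<phi> I"
  proof (rule inj_onI)
    fix u v assume uv: "u \<in> I" "v \<in> I" "\<phi> u = \<phi> v"
    then have "h {u} = h {v}" using \<phi> by simp
    then have "{u} = {v}"
      using inj_onD[OF inj] singleton_clique uv by blast
    then show "u = v" by simp
  qed
  have bij\<phi>: "bij_betw \<phi> I I"
    using endo_inj_surj[OF finite_I _ inj\<phi>] inj\<phi> \<phi> by (auto simp: bij_betw_def)
  \<comment> \<open>Non-adjacent pairs are mapped injectively to non-adjacent pairs, hence onto them.\<close>
  define N where "N = {(u, v) \<in> I \<times> I. u \<noteq> v \<and> \<not> E u v}"
  have N: "map_prod \<phi> \<phi> ` N \<subseteq> N"
  proof
    fix x assume "x \<in> map_prod \<phi> \<phi> ` N"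
    then obtain u v where uv: "x = (\<phi> u, \<phi> v)" "u \<in> I" "v \<in> I" "u \<noteq> v" "\<not> E u v"
      by (auto simp: N_def)
    then have "\<phi> u \<noteq> \<phi> v"
      using inj\<phi> by (auto dest: inj_onD)
    moreover have "facial {{\<phi> u}, {\<phi> v}}"
      using hf[of "{{u}, {v}}"] singleton_edge_iff[of u v] uv \<phi> by simp
    ultimately show "x \<in> N"
      using uv \<phi> singleton_edge_iff by (auto simp: N_def)
  qed
  have surjN: "map_prod \<phi> \<phi> ` N = N"
  proof (rule endo_inj_surj[OF _ N])
    show "finite N"
      unfolding N_def using finite_I by (auto intro: finite_subset[of _ "I \<times> I"])
    show "inj_on (map_prod \<phi> \<phi>) N"
      using map_prod_inj_on[OF inj\<phi> inj\<phi>] by (rule inj_on_subset) (auto simp: N_def)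
  qed
  have E\<phi>: "E (\<phi> u) (\<phi> v)" if "u \<in> I" "v \<in> I" "u \<noteq> v" "E u v" for u v
  proof (rule ccontr)
    assume "\<not> E (\<phi> u) (\<phi> v)"
    then have "(\<phi> u, \<phi> v) \<in> N"
      using that \<phi> inj\<phi> by (auto simp: N_def dest: inj_onD)
    then have "(\<phi> u, \<phi> v) \<in> map_prod \<phi> \<phi> ` N"
      unfolding surjN .
    then obtain u' v' where "(u', v') \<in> N" "\<phi> u' = \<phi> u" "\<phi> v' = \<phi> v"
      by auto
    then show False
      using that inj\<phi> by (auto simp: N_def dest: inj_onD)
  qed
  have E_iff: "E (\<phi> u) (\<phi> v) \<longleftrightarrow> E u v" if uv: "u \<in> I" "v \<in> I" for u v
  proof (cases "u = v \<or> E u v")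
    case True
    then show ?thesis
      using E\<phi> uv E_irrefl by auto
  next
    case False
    then have "(u, v) \<in> N"
      using uv by (simp add: N_def)
    then have "map_prod \<phi> \<phi> (u, v) \<in> N"
      by (rule subsetD[OF N imageI])
    then show ?thesis
      using False by (simp add: N_def)
  qed
  have \<phi>_aut: "\<phi> \<in> graph_automorphisms I E"
    using bij\<phi> E_iff by (simp add: graph_automorphisms_def Bij_def \<phi>_def)
  have \<phi>_clique: "\<phi> ` K \<in> cliques I E" if "K \<in> cliques I E" for K
    using that \<phi> E\<phi> unfolding cliques_def by (auto simp: subset_iff) metis
  have Pow: "h ` Pow K = Pow (\<phi> ` K)" if K: "K \<in> cliques I E" for K
  proof -
    have sub: "Pow K \<subseteq> cliques I E" and KI: "K \<subseteq> I" and fK: "finite K"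
      using clique_mono[OF K] clique_subset[OF K] finite_clique[OF K] by auto
    have "Pow (\<phi> ` K) \<subseteq> h ` Pow K"
    proof (rule facial_contains_Pow)
      show "facial (h ` Pow K)"
        by (intro hf facial_Pow K)
      show "{} \<in> h ` Pow K"
        using h_empty by (metis Pow_bottom imageI)
      show "{v} \<in> h ` Pow K" if v: "v \<in> \<phi> ` K" for v
      proof -
        obtain u where u: "u \<in> K" "v = \<phi> u" using v by blast
        then have "{v} = h {u}" using \<phi> KI by auto
        then show ?thesis using u by blast
      qed
      show "\<phi> ` K \<in> cliques I E"
        by (rule \<phi>_clique[OF K])
    qed
    moreover have "card (h ` Pow K) = card (Pow (\<phi> ` K))"
      using card_image[OF inj_on_subset[OF inj sub]] card_image[OF inj_on_subset[OF inj\<phi> KI]] fK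
      by (simp add: card_Pow)
    ultimately show ?thesis
      using fK by (intro card_subset_eq[symmetric]) auto
  qed
  have "h K = \<phi> ` K" if "K \<in> cliques I E" for K
    using finite_clique[OF that] that
  proof (induction K rule: finite_psubset_induct)
    case (psubset K)
    have "h K \<subseteq> \<phi> ` K"
      using Pow[OF psubset.prems] by blast
    then obtain L where L: "L \<subseteq> K" "h K = \<phi> ` L"
      by (auto elim: subset_imageE)
    have "L = K"
    proof (rule ccontr)
      assume "L \<noteq> K"
      then have "h L = h K"
        using psubset L clique_mono by auto
      then show False
        using inj_onD[OF inj, of L K] \<open>L \<noteq> K\<close> psubset.prems clique_mono L by auto
    qed
    then show ?case using L by simp
  qed
  with \<phi>_aut show ?thesis
    by (rule that)
qed

section \<open>Combinatorial automorphisms of clique polytopes\<close>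

definition vertex_map :: "('i \<Rightarrow> 'i) \<Rightarrow> 'e \<Rightarrow> 'e" where
  "vertex_map \<phi> = (\<lambda>x\<in>polytope_vertices P. pt (\<phi> ` inv_into (cliques I E) pt x))"

lemma inv_pt [simp]: "K \<in> cliques I E \<Longrightarrow> inv_into (cliques I E) pt (pt K) = K"
  using inj_on_pt by (rule inv_into_f_f)

lemma vertex_map_pt: "K \<in> cliques I E \<Longrightarrow> vertex_map \<phi> (pt K) = pt (\<phi> ` K)"
  by (simp add: vertex_map_def vertices_P)

lemma automorphism_clique:
  assumes "\<phi> \<in> graph_automorphisms I E" "K \<in> cliques I E"
  shows "\<phi> ` K \<in> cliques I E"
proof -
  have \<phi>: "\<phi> ` I = I" "\<And>u v. u \<in> I \<Longrightarrow> v \<in> I \<Longrightarrow> E (\<phi> u) (\<phi> v) \<longleftrightarrow> E u v"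
    using assms by (auto simp: graph_automorphisms_def Bij_def bij_betw_def)
  have K: "K \<subseteq> I" "\<And>u v. u \<in> K \<Longrightarrow> v \<in> K \<Longrightarrow> u \<noteq> v \<Longrightarrow> E u v"
    using assms by (auto simp: cliques_def)
  have "E (\<phi> u) (\<phi> v)" if "u \<in> K" "v \<in> K" "\<phi> u \<noteq> \<phi> v" for u v
    using that K \<phi>(2)[of u v] by auto
  moreover have "\<phi> ` K \<subseteq> I"
    using K(1) \<phi>(1) by blast
  ultimately show ?thesis
    by (auto simp: cliques_def)
qed

lemma automorphism_inverse:
  assumes "\<phi> \<in> graph_automorphisms I E"
  obtains \<psi> where "\<psi> \<in> graph_automorphisms I E"
    "\<And>u. u \<in> I \<Longrightarrow> \<psi> (\<phi> u) = u" "\<And>u. u \<in> I \<Longrightarrow> \<phi> (\<psi> u) = u"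
proof -
  define \<psi> where "\<psi> = (\<lambda>u\<in>I. inv_into I \<phi> u)"
  have \<phi>: "\<phi> \<in> Bij I" "bij_betw \<phi> I I" "\<And>u v. u \<in> I \<Longrightarrow> v \<in> I \<Longrightarrow> E (\<phi> u) (\<phi> v) \<longleftrightarrow> E u v"
    using assms by (auto simp: graph_automorphisms_def Bij_def)
  have 1: "\<psi> \<in> Bij I"
    unfolding \<psi>_def using \<phi>(1) by (rule restrict_inv_into_Bij)
  then have \<psi>I: "\<psi> u \<in> I" if "u \<in> I" for u
    using that Bij_imp_funcset by blast
  have 2: "\<psi> (\<phi> u) = u" if "u \<in> I" for u
    using that \<phi>(2) bij_betwE[OF \<phi>(2)] by (simp add: \<psi>_def bij_betw_inv_into_left)
  have 3: "\<phi> (\<psi> u) = u" if "u \<in> I" for u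
    using that \<phi>(2) by (simp add: \<psi>_def bij_betw_inv_into_right)
  have "E (\<psi> u) (\<psi> v) \<longleftrightarrow> E u v" if "u \<in> I" "v \<in> I" for u v
    using \<phi>(3)[OF \<psi>I \<psi>I, of u v] 3 that by simp
  then have "\<psi> \<in> graph_automorphisms I E"
    using 1 by (simp add: graph_automorphisms_def)
  then show ?thesis
    using that 2 3 by blast
qed

text \<open>
  The inverse permutation \<open>\<psi>\<close> of coordinates extends to an affine map \<open>U\<close> of the ambient space
  into itself that maps the polytope into itself; the preimage of a face under such a map is a face.
\<close>
lemma facial_automorphism_image:
  assumes "\<phi> \<in> graph_automorphisms I E" "facial X"
  shows "facial ((`) \<phi> ` X)"
proof -
  obtain \<psi> where \<psi>: "\<psi> \<in> graph_automorphisms I E"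
    "\<And>u. u \<in> I \<Longrightarrow> \<psi> (\<phi> u) = u" "\<And>u. u \<in> I \<Longrightarrow> \<phi> (\<psi> u) = u"
    using automorphism_inverse[OF assms(1)] by blast
  have \<psi>I: "\<psi> u \<in> I" if "u \<in> I" for u
    using that \<psi>(1) by (auto simp: graph_automorphisms_def dest!: Bij_imp_funcset)
  obtain F where F: "F face_of P" "X = {K \<in> cliques I E. pt K \<in> F}"
    using assms(2) by (auto simp: facial_def)
  define U where "U = (\<lambda>x. p0 + (\<Sum>i\<in>I. (c i x - c i p0) *\<^sub>R d (\<psi> i)))"
  have U_pt: "U (pt K) = pt (\<psi> ` K)" if "K \<in> cliques I E" for K
  proof -
    have KI: "K \<subseteq> I" using clique_subset[OF that] .
    have "(\<Sum>i\<in>I. (c i (pt K) - c i p0) *\<^sub>R d (\<psi> i)) = (\<Sum>i\<in>I. if i \<in> K then d (\<psi> i) else 0)"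
      by (intro sum.cong refl) (simp add: c_pt KI)
    also have "\<dots> = (\<Sum>i\<in>K. d (\<psi> i))"
      using sum.inter_restrict[OF finite_I, of "\<lambda>i. d (\<psi> i)" K] KI by (simp add: Int_absorb1)
    also have "\<dots> = (\<Sum>i\<in>\<psi> ` K. d i)"
      using inj_on_subset[OF inj_on_inverseI[where f = \<psi> and g = \<phi>, OF \<psi>(3)] KI] by (simp add: sum.reindex)
    finally show ?thesis
      by (simp add: U_def pt_def)
  qed
  have U_affine: "U ((1 - t) *\<^sub>R x + t *\<^sub>R y) = (1 - t) *\<^sub>R U x + t *\<^sub>R U y" for t x y
  proof -
    have "c i ((1 - t) *\<^sub>R x + t *\<^sub>R y) - c i p0 = (1 - t) * (c i x - c i p0) + t * (c i y - c i p0)"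
      if "i \<in> I" for i
      unfolding linear_add[OF linear_c[OF that]] linear_scale[OF linear_c[OF that]]
      by (simp add: algebra_simps)
    then have "(\<Sum>i\<in>I. (c i ((1 - t) *\<^sub>R x + t *\<^sub>R y) - c i p0) *\<^sub>R d (\<psi> i)) =
      (1 - t) *\<^sub>R (\<Sum>i\<in>I. (c i x - c i p0) *\<^sub>R d (\<psi> i)) + t *\<^sub>R (\<Sum>i\<in>I. (c i y - c i p0) *\<^sub>R d (\<psi> i))"
      by (simp add: scaleR_left_distrib sum.distrib scaleR_sum_right)
    moreover have "(1 - t) *\<^sub>R U x + t *\<^sub>R U y = ((1 - t) *\<^sub>R p0 + t *\<^sub>R p0) +
      ((1 - t) *\<^sub>R (\<Sum>i\<in>I. (c i x - c i p0) *\<^sub>R d (\<psi> i)) +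
       t *\<^sub>R (\<Sum>i\<in>I. (c i y - c i p0) *\<^sub>R d (\<psi> i)))"
      by (simp add: U_def scaleR_right_distrib)
    moreover have "(1 - t) *\<^sub>R p0 + t *\<^sub>R p0 = p0"
      by (simp flip: scaleR_left_distrib)
    ultimately show ?thesis
      by (simp add: U_def)
  qed
  have convex_U: "convex {x \<in> S. U x \<in> T}" if "convex S" "convex T" for S T
    unfolding convex_alt using that by (auto simp: U_affine convex_alt)
  have U_P: "U x \<in> P" if "x \<in> P" for x
  proof -
    have "P \<subseteq> {x \<in> UNIV. U x \<in> P}"
      unfolding P_def
      using automorphism_clique[OF \<psi>(1)]
      by (intro hull_minimal convex_U) (auto simp: U_pt intro!: hull_inc)
    then show ?thesis using that by blast
  qed
  define F' where "F' = {x \<in> P. U x \<in> F}"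
  have "F' face_of P"
    unfolding face_of_def
  proof (intro conjI ballI impI)
    show "F' \<subseteq> P" by (auto simp: F'_def)
    show "convex F'"
      unfolding F'_def using face_of_imp_convex[OF F(1)] by (intro convex_U) (auto simp: P_def)
    fix a b x assume *: "a \<in> P" "b \<in> P" "x \<in> F'" "x \<in> open_segment a b"
    then obtain t where t: "0 < t" "t < 1" "x = (1 - t) *\<^sub>R a + t *\<^sub>R b"
      unfolding in_segment by blast
    have Ux: "U x \<in> F" "U x = (1 - t) *\<^sub>R U a + t *\<^sub>R U b"
      using * t by (auto simp: F'_def U_affine)
    have "U a \<in> F \<and> U b \<in> F"
    proof (cases "U a = U b")
      case True
      then show ?thesis
        using Ux by (simp flip: scaleR_left_distrib)
    next
      case False
      then have "U x \<in> open_segment (U a) (U b)"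
        unfolding in_segment using Ux t by blast
      then show ?thesis
        using face_ofD[OF F(1)] Ux U_P * by blast
    qed
    then show "a \<in> F'" "b \<in> F'"
      using * by (auto simp: F'_def)
  qed
  moreover have "(`) \<phi> ` X = {K \<in> cliques I E. pt K \<in> F'}"
  proof (rule Set.set_eqI, rule iffI)
    fix L assume "L \<in> (`) \<phi> ` X"
    then obtain K where K: "K \<in> cliques I E" "pt K \<in> F" "L = \<phi> ` K"
      using F by auto
    then have L: "L \<in> cliques I E"
      using automorphism_clique[OF assms(1)] by simp
    have "\<psi> ` \<phi> ` K = K"
      using \<psi>(2) clique_subset[OF K(1)] by (force simp: image_image)
    then show "L \<in> {K \<in> cliques I E. pt K \<in> F'}"
      using K L by (simp add: F'_def pt_in_P U_pt)
  next
    fix L assume "L \<in> {K \<in> cliques I E. pt K \<in> F'}"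
    then have L: "L \<in> cliques I E" "pt (\<psi> ` L) \<in> F"
      by (auto simp: F'_def U_pt)
    have "\<phi> ` \<psi> ` L = L"
      using \<psi>(3) clique_subset[OF L(1)] by (force simp: image_image)
    moreover have "\<psi> ` L \<in> X"
      using F L automorphism_clique[OF \<psi>(1)] by simp
    ultimately show "L \<in> (`) \<phi> ` X"
      by (metis imageI)
  qed
  ultimately show ?thesis
    unfolding facial_def by blast
qed

lemma combinatorial_automorphisms_iff:
  "f \<in> combinatorial_automorphisms P \<longleftrightarrow>
    f \<in> Bij (polytope_vertices P) \<and> (\<forall>X. facial X \<longrightarrow> (\<exists>Y. facial Y \<and> f ` pt ` X = pt ` Y))"
  (is "_ \<longleftrightarrow> ?R")
proof
  assume f: "f \<in> combinatorial_automorphisms P"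
  have "\<exists>Y. facial Y \<and> f ` pt ` X = pt ` Y" if X: "facial X" for X
  proof -
    obtain F where F: "F face_of P" "polytope_vertices F = pt ` X"
      using X unfolding facial_iff by (elim conjE exE)
    have "\<exists>F'. F' face_of P \<and> f ` polytope_vertices F = polytope_vertices F'"
      using f F(1) by (simp add: combinatorial_automorphisms_def)
    then obtain F' where F': "F' face_of P" "f ` pt ` X = polytope_vertices F'"
      unfolding F(2) by (elim conjE exE)
    have "facial {K \<in> cliques I E. pt K \<in> F'}"
      using F'(1) by (auto simp: facial_def)
    then show ?thesis
      using F'(2) unfolding vertices_face[OF F'(1)] by (intro exI conjI)
  qed
  then show ?R
    using f by (simp add: combinatorial_automorphisms_def)
next
  assume f: ?R
  have "\<exists>F'. F' face_of P \<and> f ` polytope_vertices F = polytope_vertices F'" if F: "F face_of P" for F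
  proof -
    have "facial {K \<in> cliques I E. pt K \<in> F}"
      using F by (auto simp: facial_def)
    then have "\<exists>Y. facial Y \<and> f ` polytope_vertices F = pt ` Y"
      using f unfolding vertices_face[OF F] by simp
    then obtain Y where Y: "facial Y" "f ` polytope_vertices F = pt ` Y"
      by (elim conjE exE)
    obtain F' where "F' face_of P" "polytope_vertices F' = pt ` Y"
      using Y(1) unfolding facial_iff by (elim conjE exE)
    then show ?thesis
      using Y(2) by (intro exI[of _ F']) simp
  qed
  then show "f \<in> combinatorial_automorphisms P"
    using f by (simp add: combinatorial_automorphisms_def)
qed

lemma vertex_map_automorphism:
  assumes \<phi>: "\<phi> \<in> graph_automorphisms I E"
  shows "vertex_map \<phi> \<in> combinatorial_automorphisms P"
  unfolding combinatorial_automorphisms_iff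
proof (intro conjI allI impI)
  have img: "vertex_map \<phi> ` pt ` X = pt ` (`) \<phi> ` X" if "X \<subseteq> cliques I E" for X
    using that by (force simp: image_image vertex_map_pt)
  obtain \<psi> where \<psi>: "\<psi> \<in> graph_automorphisms I E"
    "\<And>u. u \<in> I \<Longrightarrow> \<psi> (\<phi> u) = u" "\<And>u. u \<in> I \<Longrightarrow> \<phi> (\<psi> u) = u"
    using automorphism_inverse[OF \<phi>] by blast
  have "(`) \<phi> ` cliques I E = cliques I E"
  proof
    show "(`) \<phi> ` cliques I E \<subseteq> cliques I E"
      using automorphism_clique[OF \<phi>] by blast
    show "cliques I E \<subseteq> (`) \<phi> ` cliques I E"
    proof
      fix K assume K: "K \<in> cliques I E"
      have "\<phi> ` \<psi> ` K = K"
        using \<psi>(3) clique_subset[OF K] by (force simp: image_image)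
      then show "K \<in> (`) \<phi> ` cliques I E"
        using automorphism_clique[OF \<psi>(1) K] by (metis imageI)
    qed
  qed
  then have onto: "vertex_map \<phi> ` polytope_vertices P = polytope_vertices P"
    unfolding vertices_P by (simp add: img)
  moreover have "finite (polytope_vertices P)"
    unfolding vertices_P using finite_cliques by simp
  ultimately have "bij_betw (vertex_map \<phi>) (polytope_vertices P) (polytope_vertices P)"
    by (simp add: bij_betw_def finite_surj_inj)
  then show "vertex_map \<phi> \<in> Bij (polytope_vertices P)"
    by (simp add: Bij_def vertex_map_def)
  show "\<exists>Y. facial Y \<and> vertex_map \<phi> ` pt ` X = pt ` Y" if "facial X" for X
  proof (intro exI conjI)
    show "facial ((`) \<phi> ` X)"
      by (rule facial_automorphism_image[OF \<phi> that])
    show "vertex_map \<phi> ` pt ` X = pt ` (`) \<phi> ` X"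
      using that by (intro img) (simp add: facial_iff)
  qed
qed

lemma vertex_map_surj:
  assumes und: "undominated" and f: "f \<in> combinatorial_automorphisms P"
  shows "f \<in> vertex_map ` graph_automorphisms I E"
proof -
  have fB: "f \<in> extensional (polytope_vertices P)" "bij_betw f (pt ` cliques I E) (pt ` cliques I E)"
    using f unfolding combinatorial_automorphisms_iff Bij_def vertices_P by auto
  have bij_pt: "bij_betw pt (cliques I E) (pt ` cliques I E)"
    using inj_on_pt by (simp add: bij_betw_def)
  define h where "h = inv_into (cliques I E) pt \<circ> (f \<circ> pt)"
  have bij_h: "bij_betw h (cliques I E) (cliques I E)"
    unfolding h_def using bij_betw_trans[OF bij_betw_trans[OF bij_pt fB(2)] bij_betw_inv_into[OF bij_pt]] .
  have "facial (h ` X)" if "facial X" for X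
  proof -
    obtain Y where Y: "facial Y" "f ` pt ` X = pt ` Y"
      using f \<open>facial X\<close> unfolding combinatorial_automorphisms_iff by (elim conjE allE impE exE)
    then have "h ` X = inv_into (cliques I E) pt ` pt ` Y"
      by (metis h_def image_comp)
    also have "\<dots> = Y"
      using Y(1) by (intro inv_into_image_cancel[OF inj_on_pt]) (simp add: facial_iff)
    finally show ?thesis using Y by simp
  qed
  then obtain \<phi> where \<phi>: "\<phi> \<in> graph_automorphisms I E" "\<And>K. K \<in> cliques I E \<Longrightarrow> h K = \<phi> ` K"
    using facial_bijection_induced[OF und bij_h] by blast
  have "f x = vertex_map \<phi> x" if x: "x \<in> polytope_vertices P" for x
  proof -
    obtain K where K: "K \<in> cliques I E" "x = pt K"
      using x unfolding vertices_P by blast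
    have "f x \<in> pt ` cliques I E"
      using fB(2) K by (auto simp: bij_betw_def)
    then have "pt (h K) = f x"
      using K by (simp add: h_def f_inv_into_f)
    then show ?thesis
      using K \<phi>(2) by (simp add: vertex_map_pt)
  qed
  then have "f = vertex_map \<phi>"
    using fB(1) by (intro extensionalityI[of _ "polytope_vertices P"]) (auto simp: vertex_map_def)
  then show ?thesis
    using \<phi>(1) by blast
qed

theorem graph_automorphism_group_iso:
  assumes "undominated"
  shows "graph_automorphism_group I E \<cong> combinatorial_automorphism_group P"
proof -
  have B: "graph_automorphisms I E \<subseteq> Bij I" "combinatorial_automorphisms P \<subseteq> Bij (polytope_vertices P)"
    by (auto simp: graph_automorphisms_def combinatorial_automorphisms_def)
  have "vertex_map (compose I \<phi> \<psi>) = compose (polytope_vertices P) (vertex_map \<phi>) (vertex_map \<psi>)"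
    if "\<phi> \<in> graph_automorphisms I E" "\<psi> \<in> graph_automorphisms I E" for \<phi> \<psi>
  proof (rule extensionalityI[of _ "polytope_vertices P"])
    fix x assume x: "x \<in> polytope_vertices P"
    then obtain K where K: "K \<in> cliques I E" "x = pt K"
      unfolding vertices_P by blast
    have "compose I \<phi> \<psi> ` K = \<phi> ` \<psi> ` K"
      using clique_subset[OF K(1)] by (force simp: compose_def)
    then show "vertex_map (compose I \<phi> \<psi>) x = compose (polytope_vertices P) (vertex_map \<phi>) (vertex_map \<psi>) x"
      using x K automorphism_clique that by (simp add: compose_eq vertex_map_pt)
  qed (simp_all add: vertex_map_def)
  then have "vertex_map \<in> hom (graph_automorphism_group I E) (combinatorial_automorphism_group P)"
    using B vertex_map_automorphism
    by (auto simp: hom_def graph_automorphism_group_def combinatorial_automorphism_group_def BijGroup_def subset_iff)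
  moreover have "inj_on vertex_map (graph_automorphisms I E)"
  proof (rule inj_onI)
    fix \<phi> \<psi> assume *: "\<phi> \<in> graph_automorphisms I E" "\<psi> \<in> graph_automorphisms I E" "vertex_map \<phi> = vertex_map \<psi>"
    have "\<phi> u = \<psi> u" if "u \<in> I" for u
    proof -
      have "pt (\<phi> ` {u}) = pt (\<psi> ` {u})"
        using *(3) vertex_map_pt[OF singleton_clique[OF that]] by metis
      moreover have "\<phi> ` {u} \<subseteq> I" "\<psi> ` {u} \<subseteq> I"
        using * that by (intro clique_subset automorphism_clique singleton_clique; simp)+
      ultimately have "\<phi> ` {u} = \<psi> ` {u}"
        using iffD1[OF pt_inject] by metis
      then show ?thesis by simp
    qed
    then show "\<phi> = \<psi>"
      using Bij_imp_extensional[OF subsetD[OF B(1) *(1)]] Bij_imp_extensional[OF subsetD[OF B(1) *(2)]]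
      by (intro extensionalityI[of _ I])
  qed
  moreover have "vertex_map ` graph_automorphisms I E = combinatorial_automorphisms P"
    using vertex_map_automorphism vertex_map_surj[OF assms] by blast
  ultimately have "vertex_map \<in> iso (graph_automorphism_group I E) (combinatorial_automorphism_group P)"
    by (simp add: iso_def bij_betw_def graph_automorphism_group_def combinatorial_automorphism_group_def)
  then show ?thesis
    by (rule is_isoI)
qed

end

section \<open>A graph with prescribed automorphism group\<close>

text \<open>
  The vertices form layers \<open>0, \<dots>, n\<close>, each a copy of the group.  Two layers \<open>i, j \<ge> 1\<close> are joined
  either by the identity matching or by its complement, so in both cases an automorphism that
  preserves the layers acts in the same way on all of them.  Layer \<open>0\<close> is joined to layer \<open>j\<close> by right
  multiplication with the \<open>j\<close>-th group element.  The threshold \<open>i + j > n\<close> for choosing the complement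
  makes the degrees strictly increasing in the layer, once \<open>n \<ge> 3\<close> and so the complement of a matching
  has more edges than a matching.  For \<open>i = j\<close> the rule gives an independent set or a clique.
\<close>
locale layered_graph = group G for G (structure) +
  fixes n :: nat and s :: "nat \<Rightarrow> 'a"
  assumes n: "3 \<le> n" and s: "bij_betw s {1..n} (carrier G)"
begin

definition V :: "(nat \<times> 'a) set" where "V = {0..n} \<times> carrier G"

fun adj :: "nat \<times> 'a \<Rightarrow> nat \<times> 'a \<Rightarrow> bool" where
  "adj (i, g) (j, h) \<longleftrightarrow>
    (if i = 0 then 0 < j \<and> g = h \<otimes> s j
     else if j = 0 then h = g \<otimes> s i
     else (i, g) \<noteq> (j, h) \<and> (g = h) \<noteq> (n < i + j))"

declare adj.simps [simp del]

lemma s_closed [simp]: "1 \<le> i \<Longrightarrow> i \<le> n \<Longrightarrow> s i \<in> carrier G"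
  using s by (auto simp: bij_betw_def)

lemma card_G: "card (carrier G) = n"
  using bij_betw_same_card[OF s] by simp

lemma finite_G: "finite (carrier G)"
  using bij_betw_finite[OF s] by simp

lemma finite_V: "finite V"
  unfolding V_def using finite_G by simp

lemma adj_sym: "adj u v \<Longrightarrow> adj v u"
  by (cases u; cases v) (auto simp: adj.simps add.commute split: if_splits)

lemma adj_irrefl: "\<not> adj u u"
  by (cases u) (simp add: adj.simps)

definition deg :: "nat \<times> 'a \<Rightarrow> nat" where
  "deg u = card {v \<in> V. adj u v}"

lemma deg_base:
  assumes "h \<in> carrier G"
  shows "deg (0, h) = n"
proof -
  have "{v \<in> V. adj (0, h) v} = (\<lambda>j. (j, h \<otimes> inv s j)) ` {1..n}"
    using assms by (auto simp: V_def adj.simps image_iff m_assoc inv_solve_right')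
  moreover have "inj_on (\<lambda>j. (j, h \<otimes> inv s j)) {1..n}"
    by (auto intro: inj_onI)
  ultimately show ?thesis
    by (simp add: deg_def card_image)
qed

text \<open>
  One neighbour in layer \<open>0\<close>, one in each layer \<open>j \<le> n - i\<close> other than \<open>i\<close>, and \<open>n - 1\<close> in each of the
  \<open>i\<close> layers \<open>j > n - i\<close>.
\<close>
lemma deg_layer:
  assumes i: "1 \<le> i" "i \<le> n" and g: "g \<in> carrier G"
  shows "int (deg (i, g)) = 1 + int n + int i * (int n - 2) - (if 2 * i \<le> n then 1 else 0)"
proof -
  let ?A = "({1..n - i} - {i}) \<times> {g}" and ?B = "{n - i + 1..n} \<times> (carrier G - {g})"
  have "{v \<in> V. adj (i, g) v} = insert (0, g \<otimes> s i) (?A \<union> ?B)"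
    using i g by (auto simp: V_def adj.simps split: if_splits)
  then have "deg (i, g) = Suc (card (?A \<union> ?B))"
    unfolding deg_def using finite_G by simp
  also have "card (?A \<union> ?B) = card ?A + card ?B"
    using finite_G by (intro card_Un_disjoint) auto
  also have "card ?A = n - i - (if 2 * i \<le> n then 1 else 0)"
    using i by (auto simp: card_cartesian_product card_Diff_singleton_if)
  also have "card ?B = i * (n - 1)"
    using i g finite_G by (simp add: card_cartesian_product card_G)
  finally have deg: "deg (i, g) = Suc (n - i - (if 2 * i \<le> n then 1 else 0) + i * (n - 1))" .
  have "int (i * (n - 1)) = int i * (int n - 2) + int i"
    using n by (simp add: of_nat_diff algebra_simps)
  moreover have "int (n - i - (if 2 * i \<le> n then 1 else 0)) = int n - int i - (if 2 * i \<le> n then 1 else 0)"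
    using i by (auto simp: of_nat_diff)
  ultimately show ?thesis
    unfolding deg by linarith
qed

lemma deg_eq_imp_layer_eq:
  assumes "u \<in> V" "v \<in> V" "deg u = deg v"
  shows "fst u = fst v"
proof -
  have less: "deg (i, g) < deg (j, h)"
    if ij: "i < j" "j \<le> n" "g \<in> carrier G" "h \<in> carrier G" for i j g h
  proof (cases "i = 0")
    case True
    have "0 < int j * (int n - 2)"
      using True n ij by (intro mult_pos_pos) auto
    moreover have "int n + int j * (int n - 2) \<le> int (deg (j, h))"
      using True ij by (simp add: deg_layer)
    moreover have "deg (i, g) = n"
      using True ij by (simp add: deg_base)
    ultimately have "int (deg (i, g)) < int (deg (j, h))"
      by linarith
    then show ?thesis by simp
  next
    case False
    have "(int i + 1) * (int n - 2) \<le> int j * (int n - 2)"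
      using n ij by (intro mult_right_mono) auto
    then have "int (deg (i, g)) < int (deg (j, h))"
      using False ij n by (simp add: deg_layer distrib_right)
    then show ?thesis by simp
  qed
  show ?thesis
    using assms less[of "fst u" "fst v" "snd u" "snd v"] less[of "fst v" "fst u" "snd v" "snd u"]
    by (cases "fst u" "fst v" rule: linorder_cases) (auto simp: V_def)
qed

lemma deg_automorphism:
  assumes "\<phi> \<in> graph_automorphisms V adj" "u \<in> V"
  shows "deg (\<phi> u) = deg u"
proof -
  have \<phi>: "bij_betw \<phi> V V" "\<And>u v. u \<in> V \<Longrightarrow> v \<in> V \<Longrightarrow> adj (\<phi> u) (\<phi> v) \<longleftrightarrow> adj u v"
    using assms by (auto simp: graph_automorphisms_def Bij_def)
  have "\<phi> ` {v \<in> V. adj u v} = {v \<in> \<phi> ` V. adj (\<phi> u) v}"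
    using \<phi>(2)[OF assms(2)] by auto
  then have "{v \<in> V. adj (\<phi> u) v} = \<phi> ` {v \<in> V. adj u v}"
    using \<phi>(1) by (simp add: bij_betw_def)
  moreover have "inj_on \<phi> {v \<in> V. adj u v}"
    using \<phi>(1) by (auto simp: bij_betw_def intro: inj_on_subset)
  ultimately show ?thesis
    by (simp add: deg_def card_image)
qed

definition translation :: "'a \<Rightarrow> nat \<times> 'a \<Rightarrow> nat \<times> 'a" where
  "translation a = (\<lambda>(i, g)\<in>V. (i, a \<otimes> g))"

lemma translation_apply:
  "i \<le> n \<Longrightarrow> g \<in> carrier G \<Longrightarrow> translation a (i, g) = (i, a \<otimes> g)"
  by (simp add: translation_def V_def)

lemma translation_automorphism:
  assumes a: "a \<in> carrier G"
  shows "translation a \<in> graph_automorphisms V adj"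
proof -
  have "bij_betw (translation a) V V"
  proof (rule bij_betw_byWitness[where f' = "translation (inv a)"])
    show "\<forall>v\<in>V. translation (inv a) (translation a v) = v" "\<forall>v\<in>V. translation a (translation (inv a) v) = v"
      using a by (auto simp: V_def translation_apply m_assoc[symmetric])
  qed (use a in \<open>auto simp: V_def translation_apply\<close>)
  moreover have "adj (translation a u) (translation a v) \<longleftrightarrow> adj u v" if "u \<in> V" "v \<in> V" for u v
    using that a by (auto simp: V_def translation_apply adj.simps m_assoc)
  ultimately show ?thesis
    by (simp add: graph_automorphisms_def Bij_def translation_def)
qed

text \<open>
  An automorphism preserves degrees and hence layers.  Acting by \<open>\<sigma> i\<close> on layer \<open>i\<close>, it
  satisfies \<open>\<sigma> 0 (g \<otimes> x) = \<sigma> 1 g \<otimes> x\<close> for all \<open>g\<close> and \<open>x\<close>, so that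
  \<open>\<sigma> 0 = \<sigma> 1\<close> is the left multiplication by the image of \<open>\<one>\<close>.
\<close>
lemma automorphism_is_translation:
  assumes \<phi>: "\<phi> \<in> graph_automorphisms V adj"
  shows "\<phi> \<in> translation ` carrier G"
proof -
  have \<phi>V: "\<phi> \<in> extensional V" "\<And>u. u \<in> V \<Longrightarrow> \<phi> u \<in> V"
    and adj\<phi>: "\<And>u v. u \<in> V \<Longrightarrow> v \<in> V \<Longrightarrow> adj (\<phi> u) (\<phi> v) \<longleftrightarrow> adj u v"
    using \<phi> by (auto simp: graph_automorphisms_def Bij_def bij_betw_def)
  define \<sigma> where "\<sigma> = (\<lambda>i g. snd (\<phi> (i, g)))"
  have inV: "(i, g) \<in> V" if "i \<le> n" "g \<in> carrier G" for i g
    using that by (simp add: V_def)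
  have \<sigma>: "\<phi> (i, g) = (i, \<sigma> i g)" "\<sigma> i g \<in> carrier G" if "i \<le> n" "g \<in> carrier G" for i g
  proof -
    have "fst (\<phi> (i, g)) = i"
      using deg_eq_imp_layer_eq[OF \<phi>V(2) _ deg_automorphism[OF \<phi>], of "(i, g)"] inV[OF that]
      by simp
    then show "\<phi> (i, g) = (i, \<sigma> i g)"
      by (metis \<sigma>_def prod.collapse)
    then show "\<sigma> i g \<in> carrier G"
      using \<phi>V(2)[OF inV[OF that]] by (simp add: V_def)
  qed
  have same: "\<sigma> i g = \<sigma> j g" if "1 \<le> i" "i \<le> n" "1 \<le> j" "j \<le> n" "i \<noteq> j" "g \<in> carrier G" for i j g
    using adj\<phi>[of "(i, g)" "(j, g)"] that
    by (cases "n < i + j") (simp_all add: \<sigma> inV adj.simps)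
  have base: "\<sigma> 0 (g \<otimes> s i) = \<sigma> i g \<otimes> s i" if "1 \<le> i" "i \<le> n" "g \<in> carrier G" for i g
    using adj\<phi>[of "(i, g)" "(0, g \<otimes> s i)"] that by (simp add: \<sigma> inV adj.simps)
  have base1: "\<sigma> 0 (g \<otimes> s i) = \<sigma> 1 g \<otimes> s i" if "1 \<le> i" "i \<le> n" "g \<in> carrier G" for i g
    using base[OF that] same[of i 1 g] that n by (cases "i = 1") auto
  have all: "\<exists>i. 1 \<le> i \<and> i \<le> n \<and> x = s i" if "x \<in> carrier G" for x
    using s that by (fastforce simp: bij_betw_def)
  have base2: "\<sigma> 0 (g \<otimes> x) = \<sigma> 1 g \<otimes> x" if "g \<in> carrier G" "x \<in> carrier G" for g x
    using all[OF that(2)] base1 that(1) by auto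
  define a where "a = \<sigma> 1 \<one>"
  have a: "a \<in> carrier G" using \<sigma>(2)[of 1 \<one>] n by (simp add: a_def)
  have \<sigma>0: "\<sigma> 0 g = a \<otimes> g" if "g \<in> carrier G" for g
    using base2[of \<one> g] that by (simp add: a_def)
  have \<sigma>1: "\<sigma> 1 g = a \<otimes> g" if "g \<in> carrier G" for g
    using base2[of g \<one>] that \<sigma>0[of g] \<sigma>(2)[of 1 g] n by simp
  have \<sigma>i: "\<sigma> i g = a \<otimes> g" if "i \<le> n" "g \<in> carrier G" for i g
    using \<sigma>0 \<sigma>1 same[of i 1 g] that n by (cases "i = 0 \<or> i = 1") auto
  have "\<phi> = translation a"
  proof (rule extensionalityI[of _ V])
    fix v assume "v \<in> V"
    then show "\<phi> v = translation a v"
      by (auto simp: V_def \<sigma> \<sigma>i translation_apply)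
  qed (use \<phi>V in \<open>simp_all add: translation_def\<close>)
  then show ?thesis using a by blast
qed

theorem group_iso_automorphism_group: "G \<cong> graph_automorphism_group V adj"
proof -
  have "translation (a \<otimes> b) = compose V (translation a) (translation b)"
    if "a \<in> carrier G" "b \<in> carrier G" for a b
  proof (rule extensionalityI[of _ V])
    fix v assume "v \<in> V"
    then show "translation (a \<otimes> b) v = compose V (translation a) (translation b) v"
      using that by (auto simp: V_def compose_def translation_apply m_assoc)
  qed (simp_all add: translation_def)
  moreover have "translation a \<in> Bij V" if "a \<in> carrier G" for a
    using translation_automorphism[OF that] by (simp add: graph_automorphisms_def)
  ultimately have "translation \<in> hom G (graph_automorphism_group V adj)"
    using translation_automorphism
    by (auto simp: hom_def graph_automorphism_group_def BijGroup_def)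
  moreover have "inj_on translation (carrier G)"
  proof (rule inj_onI)
    fix a b assume *: "a \<in> carrier G" "b \<in> carrier G" "translation a = translation b"
    have "translation a (0, \<one>) = translation b (0, \<one>)"
      unfolding *(3) ..
    then show "a = b"
      using *(1,2) by (simp add: translation_apply)
  qed
  moreover have "translation ` carrier G = graph_automorphisms V adj"
    using translation_automorphism automorphism_is_translation by blast
  ultimately have "translation \<in> iso G (graph_automorphism_group V adj)"
    by (simp add: iso_def bij_betw_def graph_automorphism_group_def)
  then show ?thesis by (rule is_isoI)
qed

lemma exists_avoiding_two: "\<exists>g\<in>carrier G. g \<noteq> x \<and> g \<noteq> y"
proof (rule ccontr)
  assume "\<not> ?thesis"
  then have "carrier G \<subseteq> {x, y}" by blast
  then have "card (carrier G) \<le> card {x, y}" by (intro card_mono) auto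
  also have "\<dots> \<le> 2" by (simp add: card_insert_if)
  finally show False using card_G n by simp
qed

lemma exists_non_adjacent_edge:
  assumes "u \<in> V"
  shows "\<exists>v\<in>V. \<exists>w\<in>V. adj v w \<and> v \<noteq> w \<and> u \<noteq> v \<and> u \<noteq> w \<and> \<not> adj u v \<and> \<not> adj u w"
proof -
  obtain i g where u: "u = (i, g)" "i \<le> n" "g \<in> carrier G"
    using assms by (auto simp: V_def)
  show ?thesis
  proof (cases "i = 0")
    case True
    obtain x where x: "x \<in> carrier G" "x \<noteq> g \<otimes> inv (s 1)" "x \<noteq> g \<otimes> inv (s 2)"
      using exists_avoiding_two by blast
    have "g \<noteq> x \<otimes> s 1" "g \<noteq> x \<otimes> s 2"
      using x u n by (auto simp: m_assoc)
    then show ?thesis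
      using True u n x
      by (intro bexI[of _ "(1, x)"] bexI[of _ "(2, x)"]) (auto simp: V_def adj.simps)
  next
    case False
    obtain j x where jx: "1 \<le> j" "j \<le> n" "x \<in> carrier G" "x \<otimes> s j \<noteq> g \<otimes> s i"
      "(i, g) \<noteq> (j, x)" "\<not> adj (i, g) (j, x)"
    proof (cases "i = n")
      case True
      \<comment> \<open>Layer \<open>n\<close> is joined to all layers above \<open>0\<close> by complements of matchings, hence the same \<open>g\<close>.\<close>
      have "s 1 \<noteq> s n"
        using s n by (auto simp: bij_betw_def dest: inj_onD)
      then show ?thesis
        using True u n that[of 1 g] by (auto simp: adj.simps)
    next
      case False
      obtain x where x: "x \<in> carrier G" "x \<noteq> g" "x \<noteq> g \<otimes> s i \<otimes> inv (s 1)"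
        using exists_avoiding_two by blast
      then have "x \<otimes> s 1 \<noteq> g \<otimes> s i"
        using u n \<open>i \<noteq> 0\<close> inv_solve_right[of x "g \<otimes> s i" "s 1"] by simp
      then show ?thesis
        using False x \<open>i \<noteq> 0\<close> u n that[of 1 x] by (auto simp: adj.simps)
    qed
    then show ?thesis
      using False u
      by (intro bexI[of _ "(0, x \<otimes> s j)"] bexI[of _ "(j, x)"]) (auto simp: V_def adj.simps)
  qed
qed

end

section \<open>Hamiltonian cycles as cyclic lists of nodes\<close>

lemma pcas_iff_zip_rotate1:
  "p \<noteq> [] \<and> pcas u p u \<longleftrightarrow> (\<exists>vs. vs \<noteq> [] \<and> hd vs = u \<and> p = zip vs (rotate1 vs))"
proof -
  have *: "pcas u p w \<longleftrightarrow> (if p = [] then u = w else hd (map fst p) = u \<and> map snd p = tl (map fst p) @ [w])" for u w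
    by (induction p arbitrary: u) (auto simp: neq_Nil_conv)
  show ?thesis
  proof (intro iffI conjI; (elim conjE exE)?)
    assume p: "p \<noteq> []" "pcas u p u"
    have "rotate1 (map fst p) = tl (map fst p) @ [u]"
      using p * by (cases p) auto
    then have "map snd p = rotate1 (map fst p)"
      using p * by auto
    then show "\<exists>vs. vs \<noteq> [] \<and> hd vs = u \<and> p = zip vs (rotate1 vs)"
      using p * by (intro exI[of _ "map fst p"]) (metis map_is_Nil_conv zip_map_fst_snd)
  next
    fix vs assume vs: "vs \<noteq> []" "hd vs = u" "p = zip vs (rotate1 vs)"
    then show "p \<noteq> []" by (cases vs) auto
    have "map fst p = vs" "map snd p = rotate1 vs"
      using vs by auto
    then show "pcas u p u"
      unfolding * using vs by (cases vs) auto
  qed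
qed

lemma hamiltonian_cycle_iff:
  assumes "pair_digraph D"
  shows "hamiltonian_cycle D p \<longleftrightarrow>
    (\<exists>vs. vs \<noteq> [] \<and> distinct vs \<and> set vs = pverts D \<and> set p \<subseteq> parcs D \<and> p = zip vs (rotate1 vs))"
    (is "?L \<longleftrightarrow> ?R")
proof -
  interpret pair_digraph D by fact
  have verts: "distinct (tl (awalk_verts u (zip vs (rotate1 vs)))) \<longleftrightarrow> distinct vs"
    if "pcas u (zip vs (rotate1 vs)) u" "vs \<noteq> []" for u and vs :: "'a list"
    using awalk_verts_conv'[of u "zip vs (rotate1 vs)" u] that by (auto split: if_splits)
  show ?thesis
  proof
    assume ?L
    then obtain u where u: "u \<in> pverts D" "set p \<subseteq> parcs D" "pcas u p u"
      "distinct (tl (awalk_verts u p))" "p \<noteq> []" "fst ` set p = pverts D"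
      by (auto simp: hamiltonian_cycle_def cycle_def awalk_def)
    then obtain vs where vs: "vs \<noteq> []" "hd vs = u" "p = zip vs (rotate1 vs)"
      using iffD1[OF pcas_iff_zip_rotate1[of p u]] by auto
    have "fst ` set p = set vs"
      using vs(3) by (simp flip: list.set_map)
    then show ?R
      using u vs verts[of u vs] by (intro exI[of _ vs]) auto
  next
    assume ?R
    then obtain vs where vs: "vs \<noteq> []" "distinct vs" "set vs = pverts D" "set p \<subseteq> parcs D"
      "p = zip vs (rotate1 vs)" by blast
    then have p: "p \<noteq> []" "pcas (hd vs) p (hd vs)"
      using pcas_iff_zip_rotate1[of p "hd vs"] by auto
    have "fst ` set p = set vs"
      using vs(5) by (simp flip: list.set_map)
    moreover have "hd vs \<in> pverts D"
      using vs by auto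
    ultimately show ?L
      unfolding hamiltonian_cycle_def cycle_def awalk_def
      using p vs verts[of "hd vs" vs] by auto
  qed
qed

text \<open>Going around the cycle from \<open>x\<close> reaches every node; this excludes pairs of opposite arcs.\<close>
lemma zip_rotate1_closed:
  assumes "distinct vs" "x \<in> set vs" "x \<in> X"
    and "\<And>a b. (a, b) \<in> set (zip vs (rotate1 vs)) \<Longrightarrow> a \<in> X \<Longrightarrow> b \<in> X"
  shows "set vs \<subseteq> X"
proof -
  obtain k where k: "k < length vs" "vs ! k = x"
    using assms(2) by (auto simp: in_set_conv_nth)
  have vs_ne: "0 < length vs"
    using k(1) by linarith
  have step: "vs ! (Suc m mod length vs) \<in> X" if "m < length vs" "vs ! m \<in> X" for m
  proof (rule assms(4))
    show "(vs ! m, vs ! (Suc m mod length vs)) \<in> set (zip vs (rotate1 vs))"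
      using that by (auto simp: set_zip nth_rotate1)
  qed fact
  have all: "vs ! ((k + m) mod length vs) \<in> X" for m
  proof (induction m)
    case 0
    then show ?case using k assms(3) by simp
  next
    case (Suc m)
    then show ?case
      using step[OF mod_less_divisor, of "k + m"] vs_ne by (simp add: mod_Suc_eq)
  qed
  show ?thesis
  proof
    fix y assume "y \<in> set vs"
    then obtain l where l: "l < length vs" "vs ! l = y"
      by (auto simp: in_set_conv_nth)
    have "(k + (l + length vs - k)) mod length vs = l"
      using k l by simp
    then show "y \<in> X"
      using all[of "l + length vs - k"] l by simp
  qed
qed

lemma
  assumes D: "pair_digraph D" and p: "hamiltonian_cycle D p"
  shows hamiltonian_cycle_arcs: "set p \<subseteq> parcs D"
    and hamiltonian_cycle_out: "u \<in> pverts D \<Longrightarrow> \<exists>!v. (u, v) \<in> set p"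
    and hamiltonian_cycle_in: "v \<in> pverts D \<Longrightarrow> \<exists>!u. (u, v) \<in> set p"
    and hamiltonian_cycle_no_digon: "(u, v) \<in> set p \<Longrightarrow> (v, u) \<in> set p \<Longrightarrow> pverts D \<subseteq> {u, v}"
proof -
  obtain vs where vs: "vs \<noteq> []" "distinct vs" "set vs = pverts D" "set p \<subseteq> parcs D"
      "p = zip vs (rotate1 vs)"
    using p by (auto simp: hamiltonian_cycle_iff[OF D])
  have mp: "map fst p = vs" "map snd p = rotate1 vs"
    using vs by auto
  show "set p \<subseteq> parcs D" by fact
  have out: "v = v'" if "(u, v) \<in> set p" "(u, v') \<in> set p" for u v v'
    using that mp(1) vs(2) by (metis eq_key_imp_eq_value)
  show "\<exists>!v. (u, v) \<in> set p" if "u \<in> pverts D" for u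
    using that out vs(3) unfolding mp(1)[symmetric] by force
  have inj: "inj_on snd (set p)"
    using mp(2) vs(2) by (metis distinct_map distinct1_rotate)
  show "\<exists>!u. (u, v) \<in> set p" if "v \<in> pverts D" for v
  proof -
    have "v \<in> set (map snd p)"
      unfolding mp(2) using that vs by simp
    then show ?thesis
      using inj_onD[OF inj, of "(_, v)" "(_, v)"] by (fastforce simp: image_iff)
  qed
  show "pverts D \<subseteq> {u, v}" if uv: "(u, v) \<in> set p" "(v, u) \<in> set p"
  proof -
    have "set vs \<subseteq> {u, v}"
    proof (rule zip_rotate1_closed[OF vs(2)])
      show "u \<in> set vs" "u \<in> {u,v}"
        using uv(1) unfolding mp(1)[symmetric] by force+
      show "b \<in> {u, v}" if "(a, b) \<in> set (zip vs (rotate1 vs))" "a \<in> {u, v}" for a b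
        using that uv out vs(5) by auto
    qed
    then show ?thesis using vs by simp
  qed
qed

lemma successively_join:
  "successively P (xs @ [y]) \<Longrightarrow> successively P (y # ys) \<Longrightarrow> successively P (xs @ y # ys)"
  by (auto simp: successively_append_iff)

lemma successively_concat_blocks:
  assumes "\<And>k. k < m \<Longrightarrow> successively P (f k # b k @ [f (Suc k)])"
  shows "successively P (concat (map (\<lambda>k. f k # b k) [0..<m]) @ [f m])"
  using assms
proof (induction m)
  case (Suc m)
  then show ?case
    using successively_join[of P "concat (map (\<lambda>k. f k # b k) [0..<m])" "f m" "b m @ [f (Suc m)]"]
    by simp
qed simp

lemma successively_zip_tl:
  "successively P (xs @ [z]) \<Longrightarrow> (a, b) \<in> set (zip xs (tl (xs @ [z]))) \<Longrightarrow> P a b"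
proof (induction xs)
  case (Cons x xs)
  then show ?case
    by (cases xs) auto
qed simp

lemma zip_rotate1_arcs:
  assumes "successively (\<lambda>a b. (a, b) \<in> A) (vs @ [hd vs])"
  shows "set (zip vs (rotate1 vs)) \<subseteq> A"
proof (cases vs)
  case (Cons x xs)
  then have "rotate1 vs = tl (vs @ [hd vs])" by simp
  then show ?thesis
    using successively_zip_tl[OF assms] by auto
qed simp

section \<open>The gadget digraph\<close>

text \<open>
  The nodes are hubs and gadget nodes, coded as numbers.  The hubs \<open>0, \<dots>, H - 1\<close> are joined by arcs into
  a directed cycle; hub \<open>k\<close> also offers detours to the next hub.  A gadget is a path of three nodes
  with arcs in both directions.  Its middle node \<open>gad i j 1\<close> has no further arcs, so a Hamiltonian
  cycle runs straight through the gadget, forward or backward.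
\<close>
definition hub :: "nat \<Rightarrow> nat" where
  "hub k = to_nat (Inl k :: nat + nat \<times> nat \<times> nat)"

definition gad :: "nat \<Rightarrow> nat \<Rightarrow> nat \<Rightarrow> nat" where
  "gad i j t = to_nat (Inr (i, j, t) :: nat + nat \<times> nat \<times> nat)"

lemma node_eq [simp]:
  "hub k = hub k' \<longleftrightarrow> k = k'" "gad i j t = gad i' j' t' \<longleftrightarrow> i = i' \<and> j = j' \<and> t = t'"
  "hub k \<noteq> gad i j t" "gad i j t \<noteq> hub k"
  by (auto simp: hub_def gad_def)

text \<open>
  Hub \<open>i < N\<close> starts row \<open>i\<close>, a detour running forward through its \<open>R\<close> gadgets.  Hub \<open>k \<ge> N\<close> offers one
  detour for each gadget labelled \<open>k\<close> by \<open>\<sigma>\<close>, running backward through that gadget.  If row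
  \<open>i\<close> is not taken then every one of its gadgets has to be visited backward, and two gadgets with the
  same label cannot both be.
\<close>
locale gadget_digraph =
  fixes N R H :: nat and \<sigma> :: "nat \<Rightarrow> nat \<Rightarrow> nat"
  assumes N: "0 < N" and R: "0 < R"
    and \<sigma>: "i < N \<Longrightarrow> j < R \<Longrightarrow> N \<le> \<sigma> i j \<and> \<sigma> i j < H"
begin

definition nx :: "nat \<Rightarrow> nat" where
  "nx k = Suc k mod H"

definition pre :: "nat \<Rightarrow> nat \<Rightarrow> nat" where
  "pre i j = (if j = 0 then hub i else gad i (j - 1) 2)"

definition post :: "nat \<Rightarrow> nat \<Rightarrow> nat" where
  "post i j = (if Suc j = R then hub (nx i) else gad i (Suc j) 0)"

definition direct :: "nat \<Rightarrow> nat \<times> nat" where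
  "direct k = (hub k, hub (nx k))"

definition forward :: "nat \<Rightarrow> nat \<Rightarrow> (nat \<times> nat) set" where
  "forward i j = {(pre i j, gad i j 0), (gad i j 0, gad i j 1), (gad i j 1, gad i j 2), (gad i j 2, post i j)}"

definition backward :: "nat \<Rightarrow> nat \<Rightarrow> (nat \<times> nat) set" where
  "backward i j = {(hub (\<sigma> i j), gad i j 2), (gad i j 2, gad i j 1), (gad i j 1, gad i j 0),
     (gad i j 0, hub (nx (\<sigma> i j)))}"

definition D :: "nat pair_pre_digraph" where
  "D = \<lparr>pverts = hub ` {..<H} \<union> {gad i j t | i j t. i < N \<and> j < R \<and> t < 3},
        parcs = direct ` {..<H} \<union> (\<Union>i<N. \<Union>j<R. forward i j \<union> backward i j)\<rparr>"

lemma H: "N < H"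
  using \<sigma>[OF N R] by simp

lemma nx_less: "nx k < H"
  using H by (simp add: nx_def)

lemma nx_neq: "k < H \<Longrightarrow> nx k \<noteq> k"
  using H N by (auto simp: nx_def mod_Suc)

lemma hub_in_D: "hub k \<in> pverts D \<longleftrightarrow> k < H"
  by (auto simp: D_def)

lemma gad_in_D: "gad i j t \<in> pverts D \<longleftrightarrow> i < N \<and> j < R \<and> t < 3"
  by (auto simp: D_def)

lemma parcs_D: "parcs D = direct ` {..<H} \<union> (\<Union>i<N. \<Union>j<R. forward i j \<union> backward i j)"
  by (simp add: D_def)

lemma pre_in_D: "i < N \<Longrightarrow> j < R \<Longrightarrow> pre i j \<in> pverts D"
  using H by (auto simp: pre_def hub_in_D gad_in_D)

lemma post_in_D: "i < N \<Longrightarrow> j < R \<Longrightarrow> post i j \<in> pverts D"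
  using nx_less by (simp add: post_def hub_in_D gad_in_D)

lemma pre_neq [simp]: "pre i j \<noteq> gad i j 0" and post_neq [simp]: "gad i j 2 \<noteq> post i j"
  by (auto simp: pre_def post_def)

lemma pair_digraph_D: "pair_digraph D"
proof
  fix e assume "e \<in> parcs D"
  then consider k where "k < H" "e = direct k"
    | i j where "i < N" "j < R" "e \<in> forward i j \<union> backward i j"
    unfolding parcs_D by blast
  then have "fst e \<in> pverts D \<and> snd e \<in> pverts D \<and> fst e \<noteq> snd e"
  proof cases
    case 1
    then show ?thesis
      using nx_less nx_neq[of k] by (auto simp: direct_def hub_in_D)
  next
    case 2
    then show ?thesis
      using pre_in_D post_in_D nx_less \<sigma>[of i j]
      by (auto simp: forward_def backward_def hub_in_D gad_in_D)
  qed
  then show "fst e \<in> pverts D" "snd e \<in> pverts D" "fst e \<noteq> snd e"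
    by auto
next
  have "{gad i j t | i j t. i < N \<and> j < R \<and> t < 3} = (\<lambda>(i, j, t). gad i j t) ` ({..<N} \<times> {..<R} \<times> {..<3})"
    by force
  then show "finite (pverts D)"
    by (simp add: D_def)
  show "finite (parcs D)"
    by (simp add: parcs_D forward_def backward_def)
qed

lemma out_hub_row: "(hub i, y) \<in> parcs D \<Longrightarrow> i < N \<Longrightarrow> y = hub (nx i) \<or> y = gad i 0 0"
  using \<sigma> by (fastforce simp: parcs_D direct_def forward_def backward_def pre_def split: if_splits)

lemma out_hub_seg: "(hub k, y) \<in> parcs D \<Longrightarrow> N \<le> k \<Longrightarrow>
    y = hub (nx k) \<or> (\<exists>i<N. \<exists>j<R. \<sigma> i j = k \<and> y = gad i j 2)"
  by (fastforce simp: parcs_D direct_def forward_def backward_def pre_def split: if_splits)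

lemma out_gad0: "(gad i j 0, y) \<in> parcs D \<Longrightarrow> y = gad i j 1 \<or> y = hub (nx (\<sigma> i j))"
  by (auto simp: parcs_D direct_def forward_def backward_def pre_def split: if_splits)

lemma out_gad1: "(gad i j 1, y) \<in> parcs D \<Longrightarrow> y = gad i j 0 \<or> y = gad i j 2"
  by (auto simp: parcs_D direct_def forward_def backward_def pre_def split: if_splits)

lemma in_gad1: "(x, gad i j 1) \<in> parcs D \<Longrightarrow> x = gad i j 0 \<or> x = gad i j 2"
  by (auto simp: parcs_D direct_def forward_def backward_def post_def split: if_splits)

lemma out_gad2: "(gad i j 2, y) \<in> parcs D \<Longrightarrow> y = gad i j 1 \<or> y = post i j"
  by (auto simp: parcs_D direct_def forward_def backward_def pre_def post_def split: if_splits)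

lemma in_gad0: "(x, gad i j 0) \<in> parcs D \<Longrightarrow> x = gad i j 1 \<or> x = pre i j"
  by (auto simp: parcs_D direct_def forward_def backward_def pre_def post_def split: if_splits)

lemma in_gad2: "(x, gad i j 2) \<in> parcs D \<Longrightarrow> x = gad i j 1 \<or> x = hub (\<sigma> i j)"
  by (auto simp: parcs_D direct_def forward_def backward_def post_def split: if_splits)

text \<open>\<open>K\<close> is the set of rows not taken.\<close>
definition feasible :: "nat set \<Rightarrow> bool" where
  "feasible K \<longleftrightarrow> K \<subseteq> {..<N} \<and> inj_on (\<lambda>(i, j). \<sigma> i j) (K \<times> {..<R})"

text \<open>The hubs from \<open>N\<close> on that are left by the direct arc when the rows in \<open>K\<close> are not taken.\<close>
definition idle :: "nat set \<Rightarrow> nat set" where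
  "idle K = {N..<H} - (\<lambda>(i, j). \<sigma> i j) ` (K \<times> {..<R})"

definition row_arcs :: "bool \<Rightarrow> nat \<Rightarrow> (nat \<times> nat) set" where
  "row_arcs b i = (if b then insert (direct i) (\<Union>j<R. backward i j) else (\<Union>j<R. forward i j))"

definition tour_arcs :: "nat set \<Rightarrow> (nat \<times> nat) set" where
  "tour_arcs K = (\<Union>i<N. row_arcs (i \<in> K) i) \<union> direct ` idle K"

lemma tour_arcs_determines:
  assumes "K \<subseteq> {..<N}" "K' \<subseteq> {..<N}" "tour_arcs K' \<subseteq> tour_arcs K"
  shows "K' = K"
proof -
  have 1: "direct i \<in> tour_arcs K \<longleftrightarrow> i \<in> K" if "i < N" for i K
    using that by (auto simp: tour_arcs_def row_arcs_def direct_def forward_def backward_def idle_def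
      pre_def post_def split: if_splits)
  have 2: "(hub i, gad i 0 0) \<in> tour_arcs K \<longleftrightarrow> i \<notin> K" if "i < N" for i K
    using that \<sigma> R by (auto simp: tour_arcs_def row_arcs_def direct_def forward_def backward_def idle_def
      pre_def post_def split: if_splits intro!: bexI[of _ i] bexI[of _ 0])
  have "i \<in> K' \<longleftrightarrow> i \<in> K" if "i < N" for i
    using subsetD[OF assms(3), of "direct i"] subsetD[OF assms(3), of "(hub i, gad i 0 0)"]
    unfolding 1[OF that] 2[OF that] by auto
  then show ?thesis
    using assms(1,2) by (auto simp: subset_iff)
qed

section \<open>Hamiltonian cycles of the gadget digraph\<close>

text \<open>
  Only local information is used: in- and out-degrees one, and no two opposite arcs.
  The orientation of a gadget forces its outer arcs, consecutive gadgets of a row share an arc and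
  so have the same orientation, and the orientation of the row determines everything.
\<close>
lemma tour_arcs_of_cycle:
  assumes p: "hamiltonian_cycle D p"
  obtains K where "feasible K" "set p = tour_arcs K"
proof -
  let ?A = "set p"
  note sub = subsetD[OF hamiltonian_cycle_arcs[OF pair_digraph_D p]]
  have out: "\<exists>y. (x, y) \<in> ?A" "(x, y) \<in> ?A \<Longrightarrow> (x, z) \<in> ?A \<Longrightarrow> y = z" if "x \<in> pverts D" for x y z
    using hamiltonian_cycle_out[OF pair_digraph_D p that] by auto
  have into: "\<exists>y. (y, x) \<in> ?A" "(y, x) \<in> ?A \<Longrightarrow> (z, x) \<in> ?A \<Longrightarrow> y = z" if "x \<in> pverts D" for x y z
    using hamiltonian_cycle_in[OF pair_digraph_D p that] by auto
  have no_digon: "\<not> ((gad i j 1, x) \<in> ?A \<and> (x, gad i j 1) \<in> ?A)" if "x \<noteq> hub 0" for i j x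
  proof
    assume "(gad i j 1, x) \<in> ?A \<and> (x, gad i j 1) \<in> ?A"
    then have "pverts D \<subseteq> {gad i j 1, x}"
      using hamiltonian_cycle_no_digon[OF pair_digraph_D p] by blast
    moreover have "hub 0 \<in> pverts D"
      using H by (simp add: hub_in_D)
    ultimately show False using that by auto
  qed
  have V: "gad i j 0 \<in> pverts D" "gad i j 1 \<in> pverts D" "gad i j 2 \<in> pverts D" if "i < N" "j < R" for i j
    using that by (simp_all add: gad_in_D)
  define fwd where "fwd = (\<lambda>i j. (gad i j 0, gad i j 1) \<in> ?A \<and> (gad i j 1, gad i j 2) \<in> ?A)"
  define bwd where "bwd = (\<lambda>i j. (gad i j 2, gad i j 1) \<in> ?A \<and> (gad i j 1, gad i j 0) \<in> ?A)"
  have fwd_or_bwd: "fwd i j \<or> bwd i j" if ij: "i < N" "j < R" for i j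
  proof -
    obtain x where x: "(x, gad i j 1) \<in> ?A" using into(1)[OF V(2)[OF ij]] by blast
    obtain y where y: "(gad i j 1, y) \<in> ?A" using out(1)[OF V(2)[OF ij]] by blast
    show ?thesis
      using in_gad1[OF sub[OF x]] out_gad1[OF sub[OF y]] x y
        no_digon[of "gad i j 0" i j] no_digon[of "gad i j 2" i j]
      by (auto simp: fwd_def bwd_def)
  qed
  have not_both: "\<not> (fwd i j \<and> bwd i j)" if ij: "i < N" "j < R" for i j
    using out(2)[OF V(2)[OF ij], of "gad i j 0" "gad i j 2"] by (auto simp: fwd_def bwd_def)
  have forward: "forward i j \<subseteq> ?A" if ij: "i < N" "j < R" and f: "fwd i j" for i j
  proof -
    obtain x where x: "(x, gad i j 0) \<in> ?A" using into(1)[OF V(1)[OF ij]] by blast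
    obtain y where y: "(gad i j 2, y) \<in> ?A" using out(1)[OF V(3)[OF ij]] by blast
    have "x \<noteq> gad i j 1"
      using out(2)[OF V(2)[OF ij], of "gad i j 0" "gad i j 2"] x f by (auto simp: fwd_def)
    moreover have "y \<noteq> gad i j 1"
      using into(2)[OF V(2)[OF ij], of "gad i j 0" "gad i j 2"] y f by (auto simp: fwd_def)
    ultimately show ?thesis
      using in_gad0[OF sub[OF x]] out_gad2[OF sub[OF y]] x y f by (auto simp: fwd_def forward_def)
  qed
  have backward: "backward i j \<subseteq> ?A" if ij: "i < N" "j < R" and f: "bwd i j" for i j
  proof -
    obtain x where x: "(x, gad i j 2) \<in> ?A" using into(1)[OF V(3)[OF ij]] by blast
    obtain y where y: "(gad i j 0, y) \<in> ?A" using out(1)[OF V(1)[OF ij]] by blast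
    have "x \<noteq> gad i j 1"
      using out(2)[OF V(2)[OF ij], of "gad i j 0" "gad i j 2"] x f by (auto simp: bwd_def)
    moreover have "y \<noteq> gad i j 1"
      using into(2)[OF V(2)[OF ij], of "gad i j 0" "gad i j 2"] y f by (auto simp: bwd_def)
    ultimately show ?thesis
      using in_gad2[OF sub[OF x]] out_gad0[OF sub[OF y]] x y f by (auto simp: bwd_def backward_def)
  qed
  have step: "fwd i j \<longleftrightarrow> fwd i (Suc j)" if ij: "i < N" "Suc j < R" for i j
  proof
    assume "fwd i j"
    then have "(gad i j 2, gad i (Suc j) 0) \<in> ?A"
      using forward[of i j] ij by (auto simp: forward_def post_def)
    then have "\<not> bwd i (Suc j)"
      using into(2)[OF V(1)[OF ij], of "gad i j 2" "gad i (Suc j) 1"] by (auto simp: bwd_def)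
    then show "fwd i (Suc j)"
      using fwd_or_bwd ij by blast
  next
    assume "fwd i (Suc j)"
    then have "(gad i j 2, gad i (Suc j) 0) \<in> ?A"
      using forward[of i "Suc j"] ij by (auto simp: forward_def pre_def)
    then have "\<not> bwd i j"
      using out(2)[OF V(3), of i j "gad i (Suc j) 0" "gad i j 1"] ij by (auto simp: bwd_def)
    then show "fwd i j"
      using fwd_or_bwd[of i j] ij by auto
  qed
  have row: "fwd i j \<longleftrightarrow> fwd i 0" if "i < N" "j < R" for i j
    using \<open>j < R\<close> by (induction j) (use step[OF \<open>i < N\<close>] in auto)
  define K where "K = {i. i < N \<and> bwd i 0}"
  have K: "bwd i j \<longleftrightarrow> i \<in> K" "fwd i j \<longleftrightarrow> i \<notin> K" if "i < N" "j < R" for i j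
    using that R row[OF that] fwd_or_bwd[OF that] not_both[OF that] fwd_or_bwd[of i 0] not_both[of i 0]
    by (auto simp: K_def)
  have direct_row: "direct i \<in> ?A" if i: "i \<in> K" for i
  proof -
    have iN: "i < N" using i by (simp add: K_def)
    obtain y where y: "(hub i, y) \<in> ?A"
      using out(1)[of "hub i"] iN H by (auto simp: hub_in_D)
    have "y \<noteq> gad i 0 0"
    proof
      assume "y = gad i 0 0"
      moreover have "(gad i 0 1, gad i 0 0) \<in> ?A"
        using K(1)[OF iN R] i by (simp add: bwd_def)
      ultimately show False
        using into(2)[OF V(1)[OF iN R], of "hub i" "gad i 0 1"] y by simp
    qed
    then show ?thesis
      using out_hub_row[OF sub[OF y] iN] y by (auto simp: direct_def)
  qed
  have seg_hub: "(hub k, gad i j 2) \<in> ?A \<longleftrightarrow> i \<in> K" if "i < N" "j < R" "\<sigma> i j = k" for i j k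
  proof
    assume "(hub k, gad i j 2) \<in> ?A"
    then have "\<not> fwd i j"
      using into(2)[OF V(3)[OF that(1,2)], of "hub k" "gad i j 1"] by (auto simp: fwd_def)
    then show "i \<in> K"
      using K that by blast
  next
    assume "i \<in> K"
    then show "(hub k, gad i j 2) \<in> ?A"
      using backward[of i j] K[of i j] that by (auto simp: backward_def)
  qed
  have "feasible K"
    unfolding feasible_def
  proof (intro conjI inj_onI)
    show "K \<subseteq> {..<N}" by (auto simp: K_def)
    fix a b assume ab: "a \<in> K \<times> {..<R}" "b \<in> K \<times> {..<R}" "(\<lambda>(i, j). \<sigma> i j) a = (\<lambda>(i, j). \<sigma> i j) b"
    obtain i j i' j' where eq: "a = (i, j)" "b = (i', j')" by fastforce
    then have *: "i \<in> K" "i' \<in> K" "j < R" "j' < R" "\<sigma> i j = \<sigma> i' j'" "i < N" "i' < N"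
      using ab by (auto simp: K_def)
    have "gad i j 2 = gad i' j' 2"
    proof (rule out(2)[of "hub (\<sigma> i j)"])
      show "hub (\<sigma> i j) \<in> pverts D"
        using \<sigma>[of i j] * by (simp add: hub_in_D)
      show "(hub (\<sigma> i j), gad i j 2) \<in> ?A" "(hub (\<sigma> i j), gad i' j' 2) \<in> ?A"
        using seg_hub[of i j] seg_hub[of i' j'] * by simp_all
    qed
    then show "a = b"
      using eq by simp
  qed
  have direct_seg: "direct k \<in> ?A" if k: "k \<in> idle K" for k
  proof -
    have kH: "N \<le> k" "k < H" and kK: "\<And>i j. i \<in> K \<Longrightarrow> j < R \<Longrightarrow> \<sigma> i j \<noteq> k"
      using k by (auto simp: idle_def)
    obtain y where y: "(hub k, y) \<in> ?A"
      using out(1)[of "hub k"] kH by (auto simp: hub_in_D)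
    have "y = hub (nx k)"
      using out_hub_seg[OF sub[OF y] kH(1)] y seg_hub kK by blast
    then show ?thesis
      using y by (simp add: direct_def)
  qed
  have T: "tour_arcs K \<subseteq> ?A"
    unfolding tour_arcs_def row_arcs_def
    using K forward backward direct_row direct_seg by (auto split: if_splits) blast+
  \<comment> \<open>Every node has an outgoing arc in \<open>tour_arcs K\<close>, which is its unique arc in the cycle.\<close>
  have "?A \<subseteq> tour_arcs K"
  proof
    fix e assume e: "e \<in> ?A"
    obtain x y where xy: "e = (x, y)" by fastforce
    have x: "x \<in> pverts D"
      using sub[OF e] pair_digraph_D xy by (metis pair_digraph_def pair_fin_digraph_def pair_wf_digraph.in_arcsD1)
    have "\<exists>z. (x, z) \<in> tour_arcs K"
    proof -
      consider k where "k < N" "x = hub k" | k where "N \<le> k" "k < H" "x = hub k"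
        | i j t where "i < N" "j < R" "t < 3" "x = gad i j t"
        using x by (auto simp: D_def) (metis not_le)
      then show ?thesis
      proof cases
        case 1
        then have "\<exists>z. (x, z) \<in> row_arcs (k \<in> K) k"
          using R by (cases "k \<in> K") (auto simp: row_arcs_def direct_def forward_def pre_def)
        then show ?thesis
          using 1 by (auto simp: tour_arcs_def)
      next
        case 2
        show ?thesis
        proof (cases "k \<in> idle K")
          case True
          then show ?thesis using 2 by (auto simp: tour_arcs_def direct_def)
        next
          case False
          then obtain i j where ij: "i \<in> K" "j < R" "\<sigma> i j = k"
            using 2 by (auto simp: idle_def)
          then have "(hub k, gad i j 2) \<in> row_arcs (i \<in> K) i" "i < N"
            by (auto simp: row_arcs_def backward_def K_def)
          then show ?thesis
            using 2 by (auto simp: tour_arcs_def)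
        qed
      next
        case 3
        then have "t = 0 \<or> t = 1 \<or> t = 2" by auto
        then have "\<exists>z. (x, z) \<in> row_arcs (i \<in> K) i"
          using 3 by (auto simp: row_arcs_def forward_def backward_def)
        then show ?thesis
          using 3 by (auto simp: tour_arcs_def)
      qed
    qed
    then obtain z where z: "(x, z) \<in> tour_arcs K" by blast
    then have "z = y"
      using T out(2)[OF x] e xy by blast
    then show "e \<in> tour_arcs K"
      using z xy by simp
  qed
  with T \<open>feasible K\<close> show ?thesis
    by (intro that) auto
qed

definition row :: "nat \<Rightarrow> nat list" where
  "row i = concat (map (\<lambda>j. gad i j 0 # [gad i j 1, gad i j 2]) [0..<R])"

definition detour :: "nat set \<Rightarrow> nat \<Rightarrow> nat list" where
  "detour K k =
    (if k < N then if k \<in> K then [] else row k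
     else if k \<in> idle K then []
     else case SOME (i, j). i \<in> K \<and> j < R \<and> \<sigma> i j = k of (i, j) \<Rightarrow> [gad i j 2, gad i j 1, gad i j 0])"

lemma detour_through_gadget:
  assumes K: "feasible K" and ij: "i \<in> K" "j < R" "\<sigma> i j = k"
  shows "detour K k = [gad i j 2, gad i j 1, gad i j 0]"
proof -
  have "(SOME (i, j). i \<in> K \<and> j < R \<and> \<sigma> i j = k) = (i, j)"
  proof (rule some_equality)
    fix y :: "nat \<times> nat" assume y: "case y of (i, j) \<Rightarrow> i \<in> K \<and> j < R \<and> \<sigma> i j = k"
    show "y = (i, j)"
      using y ij K inj_onD[of "\<lambda>(i, j). \<sigma> i j" "K \<times> {..<R}" y "(i, j)"]
      by (auto simp: feasible_def)
  qed (use ij in auto)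
  moreover have "i < N"
    using K ij by (auto simp: feasible_def)
  then have "N \<le> k" using \<sigma> ij by blast
  moreover have "k \<notin> idle K"
    using ij by (auto simp: idle_def)
  ultimately show ?thesis
    by (simp add: detour_def)
qed

lemma set_row: "set (row i) = {gad i j t | j t. j < R \<and> t < 3}"
proof -
  have "{0, 1, 2} = {..<3::nat}" by auto
  have "set (row i) = (\<Union>j<R. gad i j ` {0, 1, 2})"
    by (auto simp: row_def)
  also have "\<dots> = (\<Union>j<R. gad i j ` {..<3})"
    unfolding \<open>{0, 1, 2} = {..<3::nat}\<close> ..
  finally show ?thesis by auto
qed

lemma distinct_row: "distinct (row i)"
  unfolding row_def
  by (rule distinct_concat) (auto simp: distinct_map inj_on_def)

text \<open>The hub on whose detour gadget \<open>(i, j)\<close> lies; this makes the detours disjoint and exhaustive.\<close>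
definition owner :: "nat set \<Rightarrow> nat \<Rightarrow> nat \<Rightarrow> nat" where
  "owner K i j = (if i \<in> K then \<sigma> i j else i)"

lemma detour_cases:
  assumes K: "feasible K" and k: "k < H"
  obtains "detour K k = []" | "k < N" "k \<notin> K" "detour K k = row k"
    | i j where "i \<in> K" "j < R" "\<sigma> i j = k" "detour K k = [gad i j 2, gad i j 1, gad i j 0]"
proof (cases "k < N")
  case True
  then show ?thesis
    using that(1,2) by (cases "k \<in> K") (auto simp: detour_def)
next
  case False
  show ?thesis
  proof (cases "k \<in> idle K")
    case True
    then show ?thesis using False that(1) by (simp add: detour_def)
  next
    case notin: False
    then obtain i j where "i \<in> K" "j < R" "\<sigma> i j = k"
      using False k by (auto simp: idle_def)
    then show ?thesis
      using detour_through_gadget[OF K] that(3) by blast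
  qed
qed

lemma mem_detour_iff:
  assumes K: "feasible K" and k: "k < H"
  shows "x \<in> set (detour K k) \<longleftrightarrow> (\<exists>i<N. \<exists>j<R. \<exists>t<3. x = gad i j t \<and> owner K i j = k)"
proof
  have KN: "i < N" if "i \<in> K" for i
    using K that by (auto simp: feasible_def)
  have t: "0 < (3::nat)" "1 < (3::nat)" "2 < (3::nat)" by auto
  show "\<exists>i<N. \<exists>j<R. \<exists>t<3. x = gad i j t \<and> owner K i j = k" if x: "x \<in> set (detour K k)"
    using K k
  proof (cases rule: detour_cases)
    case 1
    then show ?thesis using x by simp
  next
    case 2
    then show ?thesis using x by (auto simp: set_row owner_def)
  next
    case (3 i j)
    then have "\<exists>t<3. x = gad i j t"
      using x t by (auto simp del: One_nat_def)
    then show ?thesis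
      using 3 KN by (auto simp: owner_def)
  qed
  show "x \<in> set (detour K k)" if x: "\<exists>i<N. \<exists>j<R. \<exists>t<3. x = gad i j t \<and> owner K i j = k"
  proof -
    obtain i j t where ijt: "i < N" "j < R" "t < 3" "x = gad i j t" "owner K i j = k"
      using x by blast
    show ?thesis
    proof (cases "i \<in> K")
      case True
      then have "detour K k = [gad i j 2, gad i j 1, gad i j 0]"
        using detour_through_gadget[OF K] ijt by (simp add: owner_def)
      moreover have "t = 0 \<or> t = 1 \<or> t = 2" using ijt by auto
      ultimately show ?thesis using ijt by auto
    next
      case False
      then have "detour K k = row i" "k = i"
        using ijt by (auto simp: owner_def detour_def)
      then show ?thesis using ijt by (auto simp: set_row)
    qed
  qed
qed

lemma distinct_detour:
  assumes "feasible K" "k < H"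
  shows "distinct (detour K k)"
  using assms by (cases rule: detour_cases) (auto simp: distinct_row)

text \<open>The reduction modulo \<open>H\<close> lets the block after the last one start at hub \<open>0\<close> again.\<close>
definition tour :: "nat set \<Rightarrow> nat list" where
  "tour K = concat (map (\<lambda>k. hub (k mod H) # detour K k) [0..<H])"

lemma set_tour:
  assumes K: "feasible K"
  shows "set (tour K) = pverts D"
proof -
  have own: "owner K i j < H" if "i < N" "j < R" for i j
    using that \<sigma>[OF that] H by (auto simp: owner_def)
  have "set (tour K) = hub ` {..<H} \<union> (\<Union>k<H. set (detour K k))"
    by (auto simp: tour_def)
  also have "(\<Union>k<H. set (detour K k)) = {gad i j t | i j t. i < N \<and> j < R \<and> t < 3}"
    using own by (auto simp: mem_detour_iff[OF K])
  finally show ?thesis by (simp add: D_def)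
qed

lemma distinct_tour:
  assumes K: "feasible K"
  shows "distinct (tour K)"
proof -
  have disj: "set (hub (k mod H) # detour K k) \<inter> set (hub (l mod H) # detour K l) = {}"
    if "k < H" "l < H" "k \<noteq> l" for k l
    using that by (auto simp: mem_detour_iff[OF K])
  show ?thesis
    unfolding tour_def
  proof (rule distinct_concat)
    show "distinct (map (\<lambda>k. hub (k mod H) # detour K k) [0..<H])"
      by (auto simp: distinct_map inj_on_def)
    show "distinct ys" if "ys \<in> set (map (\<lambda>k. hub (k mod H) # detour K k) [0..<H])" for ys
      using that by (auto simp: mem_detour_iff[OF K] distinct_detour[OF K])
    fix ys zs
    assume "ys \<in> set (map (\<lambda>k. hub (k mod H) # detour K k) [0..<H])"
      "zs \<in> set (map (\<lambda>k. hub (k mod H) # detour K k) [0..<H])" and neq: "ys \<noteq> zs"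
    then obtain k l where kl: "k < H" "ys = hub (k mod H) # detour K k"
      "l < H" "zs = hub (l mod H) # detour K l"
      by auto
    then have "k \<noteq> l" using neq by auto
    then show "set ys \<inter> set zs = {}"
      unfolding kl(2,4) using disj kl(1,3) by blast
  qed
qed

text \<open>Each triple of gadget nodes is a block whose successor is the start of the next one, or the next hub.\<close>
lemma row_successive:
  assumes A: "\<And>j. j < R \<Longrightarrow> forward i j \<subseteq> A"
  shows "successively (\<lambda>a b. (a, b) \<in> A) (hub i # row i @ [hub (nx i)])"
proof -
  define f where "f = (\<lambda>j. if j = R then hub (nx i) else gad i j 0)"
  have row: "row i = concat (map (\<lambda>j. f j # [gad i j 1, gad i j 2]) [0..<R])"
    unfolding row_def by (intro arg_cong[of _ _ concat] map_cong) (auto simp: f_def)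
  have "successively (\<lambda>a b. (a, b) \<in> A) (row i @ [f R])"
    unfolding row
    by (rule successively_concat_blocks) (use A in \<open>auto simp: f_def forward_def post_def\<close>)
  moreover have "hd (row i @ [f R]) = gad i 0 0"
    using R by (simp add: row_def upt_conv_Cons)
  moreover have "(hub i, gad i 0 0) \<in> A"
    using A[OF R] by (auto simp: forward_def pre_def)
  ultimately show ?thesis
    by (simp add: successively_Cons f_def)
qed

lemma hamiltonian_cycle_of_feasible:
  assumes K: "feasible K"
  obtains p where "hamiltonian_cycle D p" "set p = tour_arcs K"
proof -
  define p where "p = zip (tour K) (rotate1 (tour K))"
  have KN: "K \<subseteq> {..<N}" using K by (simp add: feasible_def)
  have fwd: "forward i j \<subseteq> tour_arcs K" if "i < N" "j < R" "i \<notin> K" for i j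
    using that by (auto simp: tour_arcs_def row_arcs_def)
  have bwd: "backward i j \<subseteq> tour_arcs K" if "j < R" "i \<in> K" for i j
    using that KN by (auto simp: tour_arcs_def row_arcs_def)
  have dir: "direct k \<in> tour_arcs K" if "k \<in> K \<or> k \<in> idle K" for k
    using that KN by (auto simp: tour_arcs_def row_arcs_def)
  have "successively (\<lambda>a b. (a, b) \<in> tour_arcs K) (tour K @ [hub (H mod H)])"
    unfolding tour_def
  proof (rule successively_concat_blocks)
    fix k assume k: "k < H"
    have "successively (\<lambda>a b. (a, b) \<in> tour_arcs K) (hub k # detour K k @ [hub (nx k)])"
      using K k
    proof (cases rule: detour_cases)
      case 1
      have "k \<in> K \<or> k \<in> idle K"
      proof (rule ccontr)
        assume "\<not> ?thesis"
        then have "detour K k \<noteq> []"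
          using R by (auto simp: detour_def row_def upt_conv_Cons split: prod.split)
        then show False using 1 by simp
      qed
      then show ?thesis
        using 1 dir[of k] by (simp add: direct_def)
    next
      case 2
      then show ?thesis
        using row_successive[of k "tour_arcs K"] fwd by simp
    next
      case (3 i j)
      then show ?thesis
        using bwd[of j i] by (auto simp: backward_def)
    qed
    then show "successively (\<lambda>a b. (a, b) \<in> tour_arcs K) (hub (k mod H) # detour K k @ [hub (Suc k mod H)])"
      using k by (simp add: nx_def)
  qed
  moreover have "hd (tour K) = hub (H mod H)"
    using H by (simp add: tour_def upt_conv_Cons)
  ultimately have sub: "set p \<subseteq> tour_arcs K"
    unfolding p_def by (intro zip_rotate1_arcs) simp
  have "tour_arcs K \<subseteq> parcs D"
    using KN H by (auto simp: tour_arcs_def row_arcs_def parcs_D idle_def split: if_splits)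
  moreover have "tour K \<noteq> []"
    using H by (simp add: tour_def upt_conv_Cons)
  ultimately have ham: "hamiltonian_cycle D p"
    using sub set_tour[OF K] distinct_tour[OF K]
    unfolding hamiltonian_cycle_iff[OF pair_digraph_D] p_def by blast
  then obtain K' where K': "feasible K'" "set p = tour_arcs K'"
    using tour_arcs_of_cycle by blast
  \<comment> \<open>So far the cycle is only known to stay within \<open>tour_arcs K\<close>; but no other tour does.\<close>
  then have "K' = K"
    using tour_arcs_determines[OF KN] sub by (simp add: feasible_def)
  then show ?thesis
    using that ham K' by simp
qed

end

section \<open>Clique polytopes are traveling-salesman polytopes\<close>

lemma lookup_scaleR:
  fixes x :: "'b \<Rightarrow>\<^sub>0 real"
  shows "Poly_Mapping.lookup (r *\<^sub>R x) e = r * Poly_Mapping.lookup x e"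
proof -
  have "finite {e. r *\<^sub>R Poly_Mapping.lookup x e \<noteq> 0}"
    by (rule finite_subset[OF _ finite_lookup[of x]]) auto
  then show ?thesis
    by (simp add: scaleR_poly_mapping_def)
qed

lemma linear_lookup: "linear (\<lambda>x :: 'b \<Rightarrow>\<^sub>0 real. Poly_Mapping.lookup x e)"
  by (rule linearI) (simp_all add: lookup_add lookup_scaleR)

lemma characteristic_vector_UNION:
  assumes "finite A" "\<And>i. i \<in> A \<Longrightarrow> finite (S i)" "\<And>i j. i \<in> A \<Longrightarrow> j \<in> A \<Longrightarrow> i \<noteq> j \<Longrightarrow> S i \<inter> S j = {}"
  shows "characteristic_vector (\<Union>i\<in>A. S i) = (\<Sum>i\<in>A. characteristic_vector (S i))"
  unfolding characteristic_vector_def using assms by (intro sum.UNION_disjoint) auto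

lemma characteristic_vector_Un:
  assumes "finite A" "finite B" "A \<inter> B = {}"
  shows "characteristic_vector (A \<union> B) = characteristic_vector A + characteristic_vector B"
  unfolding characteristic_vector_def using assms by (rule sum.union_disjoint)

context gadget_digraph
begin

definition origin :: "(nat \<times> nat) \<Rightarrow>\<^sub>0 real" where
  "origin = (\<Sum>i<N. characteristic_vector (row_arcs False i)) + (\<Sum>k\<in>{N..<H}. Poly_Mapping.single (direct k) 1)"

text \<open>
  Putting row \<open>i\<close> into \<open>K\<close> replaces its forward arcs by the backward ones and cancels the direct arcs of
  the \<open>R\<close> hubs that now make a detour.  For feasible \<open>K\<close> these hubs are all distinct, so the changes
  add up.
\<close>
definition direction :: "nat \<Rightarrow> (nat \<times> nat) \<Rightarrow>\<^sub>0 real" where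
  "direction i = characteristic_vector (row_arcs True i) - characteristic_vector (row_arcs False i)
    - (\<Sum>j<R. Poly_Mapping.single (direct (\<sigma> i j)) 1)"

lemma finite_row_arcs: "finite (row_arcs b i)"
  by (simp add: row_arcs_def forward_def backward_def)

lemma direct_inj [simp]: "direct k = direct l \<longleftrightarrow> k = l"
  by (auto simp: direct_def)

lemma row_arcs_touch:
  assumes "e \<in> row_arcs b i" "i < N"
  shows "e = direct i \<or> (\<exists>j t. fst e = gad i j t) \<or> (\<exists>k j t. e = (hub k, gad i j t))"
  using assms by (auto simp: row_arcs_def direct_def forward_def backward_def pre_def split: if_splits)

lemma row_arcs_disjoint:
  assumes "i < N" "i' < N" "i \<noteq> i'"
  shows "row_arcs b i \<inter> row_arcs b' i' = {}"
proof (rule ccontr)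
  assume "\<not> ?thesis"
  then obtain e where "e \<in> row_arcs b i" "e \<in> row_arcs b' i'" by blast
  then show False
    using row_arcs_touch[of e b i] row_arcs_touch[of e b' i'] assms by (auto simp: direct_def)
qed

lemma direct_in_row_arcs: "direct k \<in> row_arcs b i \<longleftrightarrow> b \<and> k = i"
  by (auto simp: row_arcs_def direct_def forward_def backward_def pre_def)

lemma characteristic_vector_tour_arcs:
  assumes K: "feasible K"
  shows "characteristic_vector (tour_arcs K) = origin + (\<Sum>i\<in>K. direction i)"
proof -
  have KN: "K \<subseteq> {..<N}" and inj: "inj_on (\<lambda>(i, j). \<sigma> i j) (K \<times> {..<R})"
    using K by (auto simp: feasible_def)
  let ?s = "\<lambda>k. Poly_Mapping.single (direct k) (1 :: real)"
  let ?T = "\<lambda>i. characteristic_vector (row_arcs True i)" and ?F = "\<lambda>i. characteristic_vector (row_arcs False i)"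
  have fK: "finite K" using KN finite_subset by blast
  have "characteristic_vector (tour_arcs K) =
      (\<Sum>i<N. characteristic_vector (row_arcs (i \<in> K) i)) + characteristic_vector (direct ` idle K)"
  proof -
    have "characteristic_vector (\<Union>i<N. row_arcs (i \<in> K) i) = (\<Sum>i<N. characteristic_vector (row_arcs (i \<in> K) i))"
      by (intro characteristic_vector_UNION finite_row_arcs row_arcs_disjoint) auto
    moreover have "(\<Union>i<N. row_arcs (i \<in> K) i) \<inter> direct ` idle K = {}"
      by (auto simp: direct_in_row_arcs idle_def)
    ultimately show ?thesis
      unfolding tour_arcs_def by (simp add: characteristic_vector_Un finite_row_arcs idle_def)
  qed
  also have "(\<Sum>i<N. characteristic_vector (row_arcs (i \<in> K) i)) = (\<Sum>i<N. ?F i + (if i \<in> K then ?T i - ?F i else 0))"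
    by (intro sum.cong) auto
  also have "\<dots> = (\<Sum>i<N. ?F i) + (\<Sum>i\<in>K. ?T i - ?F i)"
    using sum.inter_restrict[of "{..<N}" "\<lambda>i. ?T i - ?F i" K] KN
    by (simp add: sum.distrib Int_absorb1)
  also have "characteristic_vector (direct ` idle K) = (\<Sum>k\<in>idle K. ?s k)"
    unfolding characteristic_vector_def by (subst sum.reindex) (auto simp: inj_on_def)
  also have "\<dots> = (\<Sum>k\<in>{N..<H}. ?s k) - (\<Sum>k\<in>(\<lambda>(i, j). \<sigma> i j) ` (K \<times> {..<R}). ?s k)"
    unfolding idle_def using KN \<sigma> by (intro sum_diff) auto
  also have "(\<Sum>k\<in>(\<lambda>(i, j). \<sigma> i j) ` (K \<times> {..<R}). ?s k) = (\<Sum>i\<in>K. \<Sum>j<R. ?s (\<sigma> i j))"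
    unfolding sum.reindex[OF inj] sum.cartesian_product by (intro sum.cong) auto
  finally show ?thesis
    by (simp add: origin_def direction_def sum_subtractf sum.distrib algebra_simps)
qed

lemma lookup_direction:
  assumes "i < N" "j < N"
  shows "Poly_Mapping.lookup (direction j) (direct i) = (if i = j then 1 else 0)"
proof -
  have "i \<noteq> \<sigma> j k" if "k < R" for k
    using \<sigma>[OF assms(2) that] assms by auto
  then have "(\<Sum>k<R. Poly_Mapping.lookup (Poly_Mapping.single (direct (\<sigma> j k)) (1 :: real)) (direct i)) = 0"
    by (intro sum.neutral) (auto simp: lookup_single when_def)
  then show ?thesis
    by (simp add: direction_def lookup_minus lookup_sum lookup_characteristic_vector finite_row_arcs direct_in_row_arcs)
qed

lemma atsp_polytope_D: "atsp_polytope D = convex hull ((\<lambda>K. origin + (\<Sum>i\<in>K. direction i)) ` {K. feasible K})"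
proof -
  have "{characteristic_vector (set p) |p. hamiltonian_cycle D p} = (\<lambda>K. characteristic_vector (tour_arcs K)) ` {K. feasible K}"
    (is "?L = ?R")
  proof
    show "?L \<subseteq> ?R"
    proof
      fix x assume "x \<in> ?L"
      then obtain p where p: "x = characteristic_vector (set p)" "hamiltonian_cycle D p" by blast
      obtain K where "feasible K" "set p = tour_arcs K"
        using tour_arcs_of_cycle[OF p(2)] by blast
      then show "x \<in> ?R" using p by auto
    qed
    show "?R \<subseteq> ?L"
    proof
      fix x assume "x \<in> ?R"
      then obtain K where K: "feasible K" "x = characteristic_vector (tour_arcs K)" by blast
      obtain p where "hamiltonian_cycle D p" "set p = tour_arcs K"
        using hamiltonian_cycle_of_feasible[OF K(1)] by blast
      then show "x \<in> ?L" using K(2) by (intro CollectI exI[of _ p]) simp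
    qed
  qed
  also have "?R = (\<lambda>K. origin + (\<Sum>i\<in>K. direction i)) ` {K. feasible K}"
    by (intro image_cong refl) (simp add: characteristic_vector_tour_arcs)
  finally show ?thesis
    unfolding atsp_polytope_def by simp
qed

end

text \<open>
  Row \<open>i\<close> gets one gadget for each vertex \<open>j\<close>.  The gadgets \<open>(i, j)\<close> and \<open>(j, i)\<close> share a label exactly if
  \<open>i\<close> and \<open>j\<close> are distinct and not adjacent, and there are no other coincidences; so the feasible sets
  are the cliques.
\<close>
theorem clique_polytope_is_atsp_polytope:
  fixes I :: "'i set" and E :: "'i \<Rightarrow> 'i \<Rightarrow> bool"
  assumes I: "finite I" "I \<noteq> {}" and E: "\<And>u v. E u v \<Longrightarrow> E v u" "\<And>u. \<not> E u u"
  obtains D :: "nat pair_pre_digraph" and p0 d c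
    where "pair_digraph D" "clique_polytope I E d c" "atsp_polytope D = clique_polytope.P I E p0 d"
proof -
  define N where "N = card I"
  have N: "0 < N" using I by (simp add: N_def card_gt_0_iff)
  obtain b where b: "bij_betw b I {0..<N}"
    unfolding N_def using ex_bij_betw_finite_nat[OF I(1)] by blast
  then have bI: "inj_on b I" "b ` I = {..<N}" and bN: "\<And>u. u \<in> I \<Longrightarrow> b u < N"
    by (auto simp: bij_betw_def)
  define conflict where "conflict = (\<lambda>i j. i \<noteq> j \<and> \<not> E (inv_into I b i) (inv_into I b j))"
  have conflict_sym: "conflict i j \<longleftrightarrow> conflict j i" for i j
    using E by (auto simp: conflict_def)
  have conflict_b: "conflict (b u) (b v) \<longleftrightarrow> u \<noteq> v \<and> \<not> E u v" if "u \<in> I" "v \<in> I" for u v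
    using that bI(1) by (auto simp: conflict_def inj_on_eq_iff)
  define \<sigma> where "\<sigma> = (\<lambda>i j. N + (if conflict i j \<and> j < i then j * N + i else i * N + j))"
  have code_less: "i * N + j < N * N" if "i < N" "j < N" for i j
  proof -
    have "i * N + j < Suc i * N" using that by simp
    also have "\<dots> \<le> N * N" using that by (intro mult_right_mono) auto
    finally show ?thesis .
  qed
  have code_inj: "i * N + j = i' * N + j' \<longleftrightarrow> i = i' \<and> j = j'" if "j < N" "j' < N" for i j i' j'
  proof
    assume eq: "i * N + j = i' * N + j'"
    have "i = (i * N + j) div N" "j = (i * N + j) mod N" using that by auto
    moreover have "i' = (i' * N + j') div N" "j' = (i' * N + j') mod N" using that by auto
    ultimately show "i = i' \<and> j = j'" using eq by metis
  qed simp
  have \<sigma>_eq: "\<sigma> i j = \<sigma> i' j' \<longleftrightarrow> i = i' \<and> j = j' \<or> conflict i j \<and> i' = j \<and> j' = i"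
    if "i < N" "j < N" "i' < N" "j' < N" for i j i' j'
    using that conflict_sym[of i j] by (auto simp: \<sigma>_def code_inj conflict_def)
  interpret gadget_digraph N N "N + N * N" \<sigma>
    by unfold_locales (use N code_less in \<open>auto simp: \<sigma>_def\<close>)
  have feasible_iff: "feasible (b ` K) \<longleftrightarrow> K \<in> cliques I E" if K: "K \<subseteq> I" for K
  proof
    assume feas: "feasible (b ` K)"
    have "E u v" if uv: "u \<in> K" "v \<in> K" "u \<noteq> v" for u v
    proof (rule ccontr)
      assume "\<not> E u v"
      then have "conflict (b u) (b v)"
        using conflict_b uv K by auto
      moreover have lt: "b u < N" "b v < N" using uv K bN by auto
      ultimately have "\<sigma> (b u) (b v) = \<sigma> (b v) (b u)"
        using \<sigma>_eq[of "b u" "b v" "b v" "b u"] by simp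
      moreover have "inj_on (\<lambda>(i, j). \<sigma> i j) (b ` K \<times> {..<N})"
        using feas by (simp add: feasible_def)
      ultimately have "(b u, b v) = (b v, b u)"
        using uv lt by (elim inj_onD) auto
      then show False
        using uv K bI(1) by (auto dest: inj_onD)
    qed
    then show "K \<in> cliques I E"
      using K by (auto simp: cliques_def)
  next
    assume clique: "K \<in> cliques I E"
    have bKN: "b ` K \<subseteq> {..<N}" using K bN by auto
    have "\<not> conflict (b u) (b v)" if uv: "u \<in> K" "v \<in> K" for u v
      using conflict_b[OF subsetD[OF K uv(1)] subsetD[OF K uv(2)]] clique uv by (auto simp: cliques_def)
    then show "feasible (b ` K)"
      using bKN unfolding feasible_def by (auto intro!: inj_onI simp: \<sigma>_eq image_subset_iff)
  qed
  have feasible_eq: "{K. feasible K} = (`) b ` cliques I E"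
  proof
    show "{K. feasible K} \<subseteq> (`) b ` cliques I E"
    proof
      fix L assume "L \<in> {K. feasible K}"
      then have L: "feasible L" "L \<subseteq> b ` I"
        using bI by (auto simp: feasible_def)
      then obtain K where "K \<subseteq> I" "L = b ` K" by (auto elim: subset_imageE)
      then show "L \<in> (`) b ` cliques I E"
        using L feasible_iff by blast
    qed
    show "(`) b ` cliques I E \<subseteq> {K. feasible K}"
      using feasible_iff by (auto simp: cliques_def)
  qed
  define d where "d = direction \<circ> b"
  \<comment> \<open>The direct arc of hub \<open>i\<close> is used exactly if \<open>i\<close> is in the clique.\<close>
  define c where "c = (\<lambda>i (x :: (nat \<times> nat) \<Rightarrow>\<^sub>0 real). Poly_Mapping.lookup x (direct (b i)))"
  interpret C: clique_polytope I E origin d c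
  proof (rule clique_polytope.intro)
    show "linear (c i)" for i
      unfolding c_def by (rule linear_lookup)
    show "c i (d j) = (if i = j then 1 else 0)" if "i \<in> I" "j \<in> I" for i j
      using that bN bI(1) by (simp add: c_def d_def lookup_direction inj_on_eq_iff)
  qed (use I E in auto)
  have "(\<Sum>i\<in>b ` K. direction i) = (\<Sum>i\<in>K. d i)" if "K \<in> cliques I E" for K
    using inj_on_subset[OF bI(1) C.clique_subset[OF that]] by (simp add: sum.reindex d_def)
  then have "(\<lambda>K. origin + (\<Sum>i\<in>K. direction i)) ` {K. feasible K} = C.pt ` cliques I E"
    unfolding feasible_eq image_image C.pt_def by (intro image_cong refl) simp
  then have "atsp_polytope D = C.P"
    unfolding atsp_polytope_D C.P_def by simp
  with pair_digraph_D C.clique_polytope_axioms show ?thesis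
    by (rule that)
qed

section \<open>Groups of order at most two, and the theorem\<close>

text \<open>With two vertices, every set of vertices is the vertex set of a face.\<close>
lemma combinatorial_automorphisms_segment:
  assumes "convex P" "card (polytope_vertices P) = 2"
  shows "combinatorial_automorphisms P = Bij (polytope_vertices P)"
proof -
  have "\<exists>F'. F' face_of P \<and> f ` polytope_vertices F = polytope_vertices F'"
    if f: "f \<in> Bij (polytope_vertices P)" and F: "F face_of P" for f F
  proof -
    let ?S = "f ` polytope_vertices F"
    have "polytope_vertices F \<subseteq> polytope_vertices P"
      using extreme_point_of_face[OF F] by (auto simp: polytope_vertices_def)
    then have sub: "?S \<subseteq> polytope_vertices P"
      using Bij_imp_funcset[OF f] by blast
    obtain v w where vw: "polytope_vertices P = {v, w}"
      using assms(2) by (auto simp: card_2_iff)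
    have face: "\<exists>F'. F' face_of P \<and> S = polytope_vertices F'" if S: "S \<subseteq> {v, w}" for S
    proof -
      consider "S = {}" | x where "x \<in> {v, w}" "S = {x}" | "S = {v, w}"
        using S by blast
      then show ?thesis
      proof cases
        case 1
        then show ?thesis
          by (intro exI[of _ "{}"]) (simp add: polytope_vertices_def)
      next
        case 2
        then have "{x} face_of P"
          using vw by (auto simp: polytope_vertices_def face_of_singleton)
        then show ?thesis
          using 2 by (intro exI[of _ "{x}"]) (simp add: polytope_vertices_def)
      next
        case 3
        then show ?thesis
          using vw face_of_refl[OF assms(1)] by (intro exI[of _ P]) simp
      qed
    qed
    show ?thesis
      using sub unfolding vw by (rule face)
  qed
  then show ?thesis
    unfolding combinatorial_automorphisms_def by blast
qed

text \<open>
  Cayley's embedding by left multiplications is onto here, since a permutation of two elements is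
  determined by the image of \<open>\<one>\<close>.
\<close>
lemma BijGroup_iso_group_of_order_2:
  fixes G (structure)
  assumes "group G" "card (carrier G) = 2" "card V = 2"
  shows "BijGroup V \<cong> G"
proof -
  interpret group G by fact
  have "finite V" "finite (carrier G)"
    using assms by (auto intro: card_ge_0_finite)
  then obtain b where b: "bij_betw b V (carrier G)"
    using assms finite_same_card_bij by metis
  define r where "r = inv_into V b"
  have bG: "b x \<in> carrier G" "r (b x) = x" if "x \<in> V" for x
    using that b bij_betwE bij_betw_inv_into_left unfolding r_def by metis+
  have rV: "r g \<in> V" "b (r g) = g" if "g \<in> carrier G" for g
    using that b bij_betwE[OF bij_betw_inv_into[OF b]] bij_betw_inv_into_right unfolding r_def by metis+
  define \<Theta> where "\<Theta> = (\<lambda>a. \<lambda>x\<in>V. r (a \<otimes> b x))"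
  have \<Theta>V: "\<Theta> a x \<in> V" if "a \<in> carrier G" "x \<in> V" for a x
    using that bG rV by (simp add: \<Theta>_def)
  have comp: "\<Theta> a (\<Theta> a' x) = \<Theta> (a \<otimes> a') x" if "a \<in> carrier G" "a' \<in> carrier G" "x \<in> V" for a a' x
    using that bG rV by (simp add: \<Theta>_def m_assoc)
  have one: "\<Theta> \<one> x = x" if "x \<in> V" for x
    using that bG by (simp add: \<Theta>_def)
  have Bij: "\<Theta> a \<in> Bij V" if a: "a \<in> carrier G" for a
  proof -
    have "bij_betw (\<Theta> a) V V"
      using a \<Theta>V[OF a] \<Theta>V[OF inv_closed[OF a]]
      by (intro bij_betw_byWitness[where f' = "\<Theta> (inv a)"]) (auto simp: comp one)
    then show ?thesis by (simp add: Bij_def \<Theta>_def)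
  qed
  have "\<Theta> (a \<otimes> a') = compose V (\<Theta> a) (\<Theta> a')" if "a \<in> carrier G" "a' \<in> carrier G" for a a'
  proof (rule extensionalityI[of _ V])
    show "\<Theta> (a \<otimes> a') x = compose V (\<Theta> a) (\<Theta> a') x" if "x \<in> V" for x
      using \<open>a \<in> carrier G\<close> \<open>a' \<in> carrier G\<close> that by (simp add: compose_eq comp)
  qed (simp_all add: \<Theta>_def)
  then have "\<Theta> \<in> hom G (BijGroup V)"
    using Bij by (auto simp: hom_def BijGroup_def)
  moreover have "inj_on \<Theta> (carrier G)"
  proof (rule inj_onI)
    fix a a' assume *: "a \<in> carrier G" "a' \<in> carrier G" "\<Theta> a = \<Theta> a'"
    have "b (\<Theta> a (r \<one>)) = b (\<Theta> a' (r \<one>))" using *(3) by simp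
    then show "a = a'"
      using *(1,2) rV by (simp add: \<Theta>_def)
  qed
  moreover have "\<Theta> ` carrier G = Bij V"
  proof
    show "\<Theta> ` carrier G \<subseteq> Bij V" using Bij by blast
    show "Bij V \<subseteq> \<Theta> ` carrier G"
    proof
      fix f assume f: "f \<in> Bij V"
      then have fV: "f x \<in> V" if "x \<in> V" for x
        using that Bij_imp_funcset by blast
      have inj: "inj_on f V" using f by (simp add: Bij_def bij_betw_def)
      define a where "a = b (f (r \<one>))"
      have a: "a \<in> carrier G" using bG fV rV by (simp add: a_def)
      have uniq: "p = q" if "p \<in> carrier G" "q \<in> carrier G" "p \<noteq> a" "q \<noteq> a" for p q
        using that a assms(2) by (auto simp: card_2_iff)
      have "f x = \<Theta> a x" if x: "x \<in> V" for x
      proof (cases "b x = \<one>")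
        case True
        then have "x = r \<one>" using bG x by metis
        then show ?thesis
          using x a fV bG rV by (simp add: \<Theta>_def a_def)
      next
        case False
        have "b (f x) \<noteq> a"
        proof
          assume "b (f x) = a"
          then have "f x = f (r \<one>)"
            using bG fV rV x unfolding a_def by (metis one_closed)
          then have "x = r \<one>" using inj x rV by (auto dest: inj_onD)
          then show False using False rV by simp
        qed
        moreover have "a \<otimes> b x \<noteq> a"
          using False a bG(1)[OF x] by simp
        ultimately have "b (f x) = a \<otimes> b x"
          using uniq a bG x fV by simp
        then show ?thesis
          using x bG(2)[OF fV[OF x]] by (simp add: \<Theta>_def)
      qed
      then have "f = \<Theta> a"
        using f by (intro extensionalityI[of _ V]) (auto simp: Bij_def \<Theta>_def)
      then show "f \<in> \<Theta> ` carrier G" using a by blast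
    qed
  qed
  ultimately have "\<Theta> \<in> iso G (BijGroup V)"
    by (simp add: iso_def bij_betw_def BijGroup_def)
  then show ?thesis
    using iso_sym is_isoI by blast
qed

lemma trivial_groups_iso:
  assumes "group G" "carrier G = {g}" "group H" "carrier H = {h}"
  shows "G \<cong> H"
proof -
  interpret G: group G by fact
  interpret H: group H by fact
  have "h \<otimes>\<^bsub>H\<^esub> h = h"
    using H.m_closed[of h h] assms by simp
  then have "(\<lambda>_. h) \<in> iso G H"
    using assms by (auto simp: iso_def hom_def bij_betw_def)
  then show ?thesis by (rule is_isoI)
qed

theorem mainTheorem3:
  fixes G :: "('a, 'b) monoid_scheme"
  assumes "group G" and "finite (carrier G)"
  shows "\<exists>D :: nat pair_pre_digraph.
           pair_digraph D \<and> combinatorial_automorphism_group (atsp_polytope D) \<cong> G"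
proof -
  interpret G: group G by fact
  have pos: "0 < card (carrier G)"
    using assms(2) by (auto simp: card_gt_0_iff)
  consider "card (carrier G) = 1" | "card (carrier G) = 2" | "3 \<le> card (carrier G)"
    using pos by linarith
  then show ?thesis
  proof cases
    case 1
    define D :: "nat pair_pre_digraph" where "D = \<lparr>pverts = {}, parcs = {}\<rparr>"
    have D: "pair_digraph D"
      by unfold_locales (auto simp: D_def)
    have "\<not> hamiltonian_cycle D p" for p
      unfolding hamiltonian_cycle_iff[OF D] by (auto simp: D_def)
    then have "atsp_polytope D = {}"
      by (simp add: atsp_polytope_def)
    then have empty: "polytope_vertices (atsp_polytope D) = {}"
      by (simp add: polytope_vertices_def)
    have "carrier (combinatorial_automorphism_group (atsp_polytope D)) \<subseteq> {\<lambda>x. undefined}"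
      by (auto simp: combinatorial_automorphism_group_def combinatorial_automorphisms_def Bij_def empty)
    moreover have grp: "group (combinatorial_automorphism_group (atsp_polytope D))"
      by (rule group_combinatorial_automorphism_group[OF finite_vertices_atsp_polytope[OF D]])
    ultimately have "carrier (combinatorial_automorphism_group (atsp_polytope D)) = {\<lambda>x. undefined}"
      using monoid.one_closed[OF group.is_monoid[OF grp]] by (auto dest: subset_singletonD)
    moreover obtain g where "carrier G = {g}"
      using 1 by (rule card_1_singletonE)
    ultimately have "combinatorial_automorphism_group (atsp_polytope D) \<cong> G"
      using grp assms(1) by (intro trivial_groups_iso)
    then show ?thesis using D by blast
  next
    case 2
    obtain D :: "nat pair_pre_digraph" and p0 d c where D: "pair_digraph D"
      "clique_polytope {()} (\<lambda>_ _. False) d c" "atsp_polytope D = clique_polytope.P {()} (\<lambda>_ _. False) p0 d"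
      by (rule clique_polytope_is_atsp_polytope[of "{()}" "\<lambda>_ _. False"]) simp_all
    interpret C: clique_polytope "{()}" "\<lambda>_ _. False" p0 d c by fact
    have "cliques {()} (\<lambda>_ _. False) = {{}, {()}}"
      by (auto simp: cliques_def)
    then have "card (polytope_vertices C.P) = 2"
      using C.inj_on_pt by (simp add: C.vertices_P card_image)
    moreover from this have "combinatorial_automorphisms C.P = Bij (polytope_vertices C.P)"
      by (intro combinatorial_automorphisms_segment) (auto simp: C.P_def)
    then have "combinatorial_automorphism_group C.P = BijGroup (polytope_vertices C.P)"
      by (simp add: combinatorial_automorphism_group_def BijGroup_def)
    ultimately have "combinatorial_automorphism_group (atsp_polytope D) \<cong> G"
      using BijGroup_iso_group_of_order_2[OF assms(1) 2] D(3) by simp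
    then show ?thesis using D by blast
  next
    case 3
    obtain s where s: "bij_betw s {1..card (carrier G)} (carrier G)"
      using ex_bij_betw_nat_finite_1[OF assms(2)] by blast
    interpret L: layered_graph G "card (carrier G)" s
      by unfold_locales (use 3 s in auto)
    have "L.V \<noteq> {}"
      by (auto simp: L.V_def)
    from L.finite_V this L.adj_sym L.adj_irrefl
    obtain D :: "nat pair_pre_digraph" and p0 d c where D: "pair_digraph D"
      "clique_polytope L.V L.adj d c" "atsp_polytope D = clique_polytope.P L.V L.adj p0 d"
      by (rule clique_polytope_is_atsp_polytope)
    interpret C: clique_polytope L.V L.adj p0 d c by fact
    have "C.undominated"
      unfolding C.undominated_def using L.exists_non_adjacent_edge by blast
    then have "graph_automorphism_group L.V L.adj \<cong> combinatorial_automorphism_group C.P"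
      by (rule C.graph_automorphism_group_iso)
    then have "G \<cong> combinatorial_automorphism_group C.P"
      by (rule iso_trans[OF L.group_iso_automorphism_group])
    then have "combinatorial_automorphism_group (atsp_polytope D) \<cong> G"
      unfolding D(3) by (rule G.iso_sym)
    then show ?thesis using D by blast
  qed
qed

end
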